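(* Under the standing assumptions in the context, for each $j\in\{1,\dots,\bar k\}$ put $\bm{\bar x}_j:=(\bar x,\bar y,\bar\mu_j)$. Then the mappings $\mathcal G^j_{\bm{\bar x}_j}$, $j\in\{1,\dots,\bar k\}$, are strongly metrically regular at $\bm{\bar x}_j$ for $\bm 0$. Moreover, for all $j\in\{1,\dots,\bar k\}$ there exists a neighborhood $U_j$ of $\bm{\bar x}_j$ such that, for every $\bm x^0\in U_j$, there is a unique sequence $\bm x_j^k=(x^k,y^k,\mu_j^k)$ in $U_j$ (starting at $\bm x^0$) generated by Newton's method for $g_j+G_0$, i.e. with $$\bm 0\in g_j(\bm x_j^{k})+\nabla g_j(\bm x_j^{k})(\bm x_j^{k+1}-\bm x_j^{k})+G_0\quad\text{for all }k\ge 0.$$ Both this sequence and the sequence $(x^k,y^k)$ converge at a quadratic rate, to $\bm{\bar x}_j$ and $(\bar x,\bar y)$ respectively.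
   Context: Representation of $h$. $h:\mathbb{R}^m\to\mathbb{R}\cup\{+\infty\}$ is a proper convex function with $\mathrm{int}\,\mathrm{dom}(h)\neq\emptyset$ and $\mathrm{dom}(h)=\bigcup_{k=1}^{\mathcal K}C_k$, where on each $C_k$, $h(c)=\frac12\langle c,Q_kc\rangle+\langle b_k,c\rangle+\beta_k$ ($Q_k$ symmetric), and there are $(a_j,\alpha_j)\in(\mathbb{R}^m\setminus\{0\})\times\mathbb{R}$, $j=1,\dots,s$, and $\omega_{kj}\in\{\pm1\}$ with $C_k=\{c:\langle\omega_{kj}a_j,c\rangle\le\omega_{kj}\alpha_j,\ j=1,\dots,s\}$, $\mathrm{int}\,C_k=\{c:\langle\omega_{kj}a_j,c\rangle<\omega_{kj}\alpha_j,\ j=1,\dots,s\}\ne\emptyset$, and $\mathrm{int}\,C_{k_1}\cap\mathrm{int}\,C_{k_2}=\emptyset$ for $k_1\ne k_2$. Let $\mathcal K(c)=\{k:c\in C_k\}$ and $I_k(c)=\{j:\langle a_j,c\rangle=\alpha_j\}$. Active manifold and matrices. $c:\mathbb{R}^n\to\mathbb{R}^m$ is $C^3$-smooth, $f=h\circ c$, $\bar x\in\mathrm{dom}(f)$, $\bar c=c(\bar x)$, $\mathcal K(\bar c)=\{k_1,\dots,k_{\bar k}\}$ with $\bar k\ge2$, $\mathcal M_{\bar c}:=\mathrm{ri}\big(\bigcap_{k\in\mathcal K(\bar c)}C_k\big)$, with $\bar c\in\mathcal M_{\bar c}$. Let $\ell=|I_k(\bar c)|$ (independent of $k\in\mathcal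 K(\bar c)$). $A\in\mathbb{R}^{m\times\ell}$ has columns $\omega_{k_{\bar k}j}a_j$, $j\in I_{k_{\bar k}}(\bar c)$, in a fixed order, and $P_i$ is the $\ell\times\ell$ diagonal matrix with $\pm1$ entries such that $AP_i$ has columns $\omega_{k_ij}a_j$ in the same order. Assumptions. (i) $\mathrm{Null}(A)=\{0\}$. (ii) $\mathrm{Null}(\nabla c(\bar x)^\top)\cap\mathrm{ri}(\partial h(\bar c))=\{\bar y\}$, and $\bar\mu=(\bar\mu_1^\top,\dots,\bar\mu_{\bar k}^\top)^\top$ satisfies $\bar y=Q_{k_i}\bar c+b_{k_i}+AP_i\bar\mu_i$ for all $i$, with $\bar\mu>0$ componentwise. (iii) $h''(\bar c;\nabla c(\bar x)d)+\langle d,\nabla^2(\bar yc)(\bar x)d\rangle>0$ for all $d\in\mathrm{Null}(A^\top\nabla c(\bar x))\setminus\{0\}$, where $(yc)(x)=\langle y,c(x)\rangle$, $\nabla c(x)$ is the $m\times n$ Jacobian and $h''(c;w)=\lim_{t\searrow0}\frac{h(c+tw)-h(c)-th'(c;w)}{t^2/2}$. Mappings. For $j\in\{1,\dots,\bar k\}$, $g_j:\mathbb{R}^{n+m+\ell}\to\mathbb{R}^{n+m+\ell+\ell}$ and $G_0$ are $$g_j(x,y,\mu_j)=\begin{pmatrix}\nabla c(x)^\top y\\ y-Q_{k_j}c(x)-b_{k_j}-AP_j\mu_j\\ A^\top[c(x)-\bar c]\\ -\mu_j\end{pmatrix},\qquad G_0=\{0\}^n\times\{0\}^m\times\{0\}^\ell\times\mathbb{R}^\ell_+,$$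 and for $\bm u\in\mathbb{R}^{n+m+\ell}$, $\mathcal G^j_{\bm u}(\bm x):=g_j(\bm u)+\nabla g_j(\bm u)(\bm x-\bm u)+G_0$. A set-valued mapping $S$ is strongly metrically regular at $\bar z$ for $\bar w$ if $\bar w\in S(\bar z)$ and $S^{-1}$ has a Lipschitz continuous single-valued localization around $\bar w$ for $\bar z$ (there are neighborhoods $V$ of $\bar w$, $U$ of $\bar z$ such that $w\mapsto S^{-1}(w)\cap U$ is single-valued and Lipschitz on $V$). *)

theory Defs
  imports "HOL-Analysis.Analysis"
begin

definition eff_dom :: "('a \<Rightarrow> ereal) \<Rightarrow> 'a set" where
  "eff_dom h = {z. h z < \<infinity>}"

definition proper_fun :: "('a \<Rightarrow> ereal) \<Rightarrow> bool" where
  "proper_fun h \<longleftrightarrow> (\<forall>z. h z \<noteq> -\<infinity>) \<and> eff_dom h \<noteq> {}"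

(* The library's epigraph and convex_on are for real-valued functions only. *)
definition convex_fun :: "('a::real_vector \<Rightarrow> ereal) \<Rightarrow> bool" where
  "convex_fun h \<longleftrightarrow> convex {(z, r::real). h z \<le> ereal r}"

definition subdifferential :: "('a::real_inner \<Rightarrow> ereal) \<Rightarrow> 'a \<Rightarrow> 'a set" where
  "subdifferential h z = {y. z \<in> eff_dom h \<and> (\<forall>w. h w \<ge> h z + ereal (y \<bullet> (w - z)))}"

(* Lim is unspecified where the limit does not exist.  For a piecewise linear-quadratic h and
   z + t w in eff_dom h for small t > 0, both limits below exist and are finite. *)
definition dir_deriv :: "('a::real_vector \<Rightarrow> ereal) \<Rightarrow> 'a \<Rightarrow> 'a \<Rightarrow> ereal" where
  "dir_deriv h z w = Lim (at_right 0) (\<lambda>t::real. (h (z + t *\<^sub>R w) - h z) / ereal t)"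

definition second_dir_deriv :: "('a::real_vector \<Rightarrow> ereal) \<Rightarrow> 'a \<Rightarrow> 'a \<Rightarrow> ereal" where
  "second_dir_deriv h z w =
     Lim (at_right 0)
       (\<lambda>t::real. (h (z + t *\<^sub>R w) - h z - ereal t * dir_deriv h z w) / ereal (t\<^sup>2 / 2))"

(* In finite dimensions this is the usual C^k: the map is differentiable everywhere and each
   directional derivative x |-> Df(x) v is C^(k-1). *)
primrec Ck_smooth :: "nat \<Rightarrow> ('a::real_normed_vector \<Rightarrow> 'b::real_normed_vector) \<Rightarrow> bool" where
  "Ck_smooth 0 f \<longleftrightarrow> continuous_on UNIV f"
| "Ck_smooth (Suc k) f \<longleftrightarrow>
     (\<forall>x. f differentiable (at x)) \<and> (\<forall>v. Ck_smooth k (\<lambda>x. frechet_derivative f (at x) v))"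

definition gradient :: "(real ^ 'n \<Rightarrow> real) \<Rightarrow> real ^ 'n \<Rightarrow> real ^ 'n" where
  "gradient f x = (\<chi> i. frechet_derivative f (at x) (axis i 1))"

definition hessian :: "(real ^ 'n \<Rightarrow> real) \<Rightarrow> real ^ 'n \<Rightarrow> real ^ 'n ^ 'n" where
  "hessian f x = jacobian (gradient f) (at x)"

definition null_space :: "real ^ 'n ^ 'm \<Rightarrow> (real ^ 'n) set" where
  "null_space A = {x. A *v x = 0}"

definition active_pieces :: "nat \<Rightarrow> (nat \<Rightarrow> 'a set) \<Rightarrow> 'a \<Rightarrow> nat set" where
  "active_pieces K C z = {k \<in> {1..K}. z \<in> C k}"

(* The hyperplanes are shared by all pieces, so this set does not depend on the piece. *)
definition active_constraints ::
  "nat \<Rightarrow> (nat \<Rightarrow> 'a::real_inner) \<Rightarrow> (nat \<Rightarrow> real) \<Rightarrow> 'a \<Rightarrow> nat set" where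
  "active_constraints s a \<alpha> z = {j \<in> {1..s}. a j \<bullet> z = \<alpha> j}"

definition active_manifold :: "nat \<Rightarrow> (nat \<Rightarrow> ('a::euclidean_space) set) \<Rightarrow> 'a \<Rightarrow> 'a set" where
  "active_manifold K C z = rel_interior (\<Inter>k\<in>active_pieces K C z. C k)"

definition strongly_metrically_regular ::
  "('a::metric_space \<Rightarrow> 'b::metric_space set) \<Rightarrow> 'a \<Rightarrow> 'b \<Rightarrow> bool" where
  "strongly_metrically_regular S z w \<longleftrightarrow>
     w \<in> S z \<and>
     (\<exists>V U \<sigma> L. open V \<and> w \<in> V \<and> open U \<and> z \<in> U \<and>
        (\<forall>v\<in>V. {u. v \<in> S u} \<inter> U = {\<sigma> v}) \<and> L-lipschitz_on V \<sigma>)"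

definition linearized_map ::
  "('a::real_normed_vector \<Rightarrow> 'b::real_normed_vector) \<Rightarrow> 'b set \<Rightarrow> 'a \<Rightarrow> 'a \<Rightarrow> 'b set" where
  "linearized_map g G0 u x = (\<lambda>z. g u + frechet_derivative g (at u) (x - u) + z) ` G0"

definition newton_sequence ::
  "('a::real_normed_vector \<Rightarrow> 'b::real_normed_vector) \<Rightarrow> 'b set \<Rightarrow> (nat \<Rightarrow> 'a) \<Rightarrow> bool" where
  "newton_sequence g G0 X \<longleftrightarrow> (\<forall>k. 0 \<in> linearized_map g G0 (X k) (X (Suc k)))"

definition converges_quadratically :: "(nat \<Rightarrow> 'a::metric_space) \<Rightarrow> 'a \<Rightarrow> bool" where
  "converges_quadratically X l \<longleftrightarrow>
     X \<longlonglongrightarrow> l \<and> (\<exists>\<gamma>. \<forall>k. dist (X (Suc k)) l \<le> \<gamma> * (dist (X k) l)\<^sup>2)"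

definition g_map ::
  "(real ^ 'n \<Rightarrow> real ^ 'm) \<Rightarrow> real ^ 'm \<Rightarrow> real ^ 'm ^ 'm \<Rightarrow> real ^ 'm \<Rightarrow>
   real ^ 'l ^ 'm \<Rightarrow> real ^ 'l ^ 'l \<Rightarrow>
   (real ^ 'n) \<times> (real ^ 'm) \<times> (real ^ 'l) \<Rightarrow>
   (real ^ 'n) \<times> (real ^ 'm) \<times> (real ^ 'l) \<times> (real ^ 'l)" where
  "g_map c cbar Q b A P =
     (\<lambda>(x, y, \<mu>).
        (transpose (jacobian c (at x)) *v y,
         y - Q *v c x - b - (A ** P) *v \<mu>,
         transpose A *v (c x - cbar),
         - \<mu>))"

definition G0_set :: "((real ^ 'n) \<times> (real ^ 'm) \<times> (real ^ 'l) \<times> (real ^ 'l)) set" where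
  "G0_set = {0} \<times> {0} \<times> {0} \<times> {p. \<forall>i. 0 \<le> p $ i}"

end

theory Submission
  imports Defs
begin

text \<open>
  The map \<open>g\<^sub>j\<close> is affine in the multiplier, and its last block together with the positivity of the
  reference multiplier makes the sign constraint inactive near the solution.  Locally the Newton
  inclusion is therefore a square linear system \<open>\<Phi> w z + \<rho> w = 0\<close> whose coefficients depend on
  \<open>w = (x, y)\<close> only.  This is why the new error is bounded by the square of the old error in \<open>(x, y)\<close>
  alone, which gives both quadratic rates at once.

  The system is nonsingular at the solution.  A kernel element \<open>(d, \<eta>, \<nu>)\<close> gives zero in the second
  order condition, because \<open>h\<close> is quadratic along directions in the null space of the transpose of
  \<open>A\<close>; hence \<open>d = 0\<close>.  Then \<open>\<eta>\<close> lies in the range of \<open>A\<close>, and all multipliers being positive, a small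
  multiple of \<open>\<eta>\<close> can be added to the reference dual vector without leaving the relative interior of
  the subdifferential, so uniqueness of that dual vector forces \<open>\<eta> = 0\<close> and \<open>\<nu> = 0\<close>.
\<close>

section \<open>Smooth maps\<close>

lemma Ck_smooth_SucD: "Ck_smooth (Suc k) f \<Longrightarrow> Ck_smooth k f"
proof (induction k arbitrary: f)
  case 0
  then show ?case
    by (auto simp: continuous_on_eq_continuous_at differentiable_imp_continuous_within)
next
  case (Suc k)
  then show ?case by (metis Ck_smooth.simps(2))
qed

text \<open>Derivatives are unique, so any candidate \<open>D\<close> supplied by a differentiation
  rule can stand in for \<open>frechet_derivative\<close>. The closure rules below rest on
  this.\<close>

lemma Ck_smooth_SucI:
  assumes "\<And>x. (f has_derivative D x) (at x)" "\<And>v. Ck_smooth k (\<lambda>x. D x v)"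
  shows "Ck_smooth (Suc k) f"
proof -
  have "frechet_derivative f (at x) = D x" for x
    using frechet_derivative_at[OF assms(1)] by simp
  then show ?thesis using assms by (auto intro: differentiableI)
qed

lemma Ck_smooth_Suc_has_derivative:
  "Ck_smooth (Suc k) f \<Longrightarrow> (f has_derivative frechet_derivative f (at x)) (at x)"
  by (simp add: frechet_derivative_works[symmetric])

lemma Ck_smooth_2_differentiable: "Ck_smooth 2 f \<Longrightarrow> f differentiable (at x)"
  by (simp add: numeral_2_eq_2)

lemma Ck_smooth_const: "Ck_smooth k (\<lambda>x. z)"
  by (induction k arbitrary: z) (auto intro: Ck_smooth_SucI[where D = "\<lambda>x v. 0"] simp del: Ck_smooth.simps(2))

lemma Ck_smooth_compose_linear:
  assumes "bounded_linear L" "Ck_smooth k f"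
  shows "Ck_smooth k (\<lambda>x. L (f x))"
  using assms(2)
proof (induction k arbitrary: f)
  case 0
  then show ?case
    using assms(1) by (auto intro: bounded_linear.continuous_on)
next
  case (Suc k)
  show ?case
    by (rule Ck_smooth_SucI[OF bounded_linear.has_derivative[OF assms(1)
          Ck_smooth_Suc_has_derivative[OF Suc.prems]]])
      (use Suc in auto)
qed

text \<open>A linear inner map makes the induction close: the derivative in direction
  \<open>v\<close> is again such a composite, of the derivative of \<open>f\<close> in the fixed
  direction \<open>L v\<close>. This is what turns smoothness of \<open>c\<close> in
  \<open>x\<close> into smoothness in the pair \<open>(x, y)\<close>.\<close>

lemma Ck_smooth_linear_arg:
  assumes "bounded_linear L" "Ck_smooth k f"
  shows "Ck_smooth k (\<lambda>x. f (L x))"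
  using assms(2)
proof (induction k arbitrary: f)
  case 0
  then show ?case
    using continuous_on_compose2[of UNIV f UNIV L] linear_continuous_on[OF assms(1)] by auto
next
  case (Suc k)
  have "Ck_smooth k (\<lambda>x. frechet_derivative f (at (L x)) (L v))" for v
    using Suc.IH[of "\<lambda>y. frechet_derivative f (at y) (L v)"] Suc.prems by simp
  then show ?case
    by (rule Ck_smooth_SucI[OF has_derivative_compose[OF
          bounded_linear_imp_has_derivative[OF assms(1)] Ck_smooth_Suc_has_derivative[OF Suc.prems]]])
qed

lemma Ck_smooth_linear:
  assumes "bounded_linear L" shows "Ck_smooth k L"
proof (cases k)
  case 0
  then show ?thesis using linear_continuous_on[OF assms] by simp
next
  case (Suc k)
  show ?thesis unfolding Suc
    by (rule Ck_smooth_SucI[OF bounded_linear_imp_has_derivative[OF assms]]) (rule Ck_smooth_const)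
qed

lemma Ck_smooth_add:
  assumes "Ck_smooth k f" "Ck_smooth k g"
  shows "Ck_smooth k (\<lambda>x. f x + g x)"
  using assms
proof (induction k arbitrary: f g)
  case 0
  then show ?case by (auto intro: continuous_on_add)
next
  case (Suc k)
  show ?case
    by (rule Ck_smooth_SucI[OF has_derivative_add[OF Suc.prems[THEN Ck_smooth_Suc_has_derivative]]])
      (use Suc in auto)
qed

lemma Ck_smooth_diff:
  assumes "Ck_smooth k f" "Ck_smooth k g"
  shows "Ck_smooth k (\<lambda>x. f x - g x)"
  using Ck_smooth_add[OF assms(1) Ck_smooth_compose_linear[OF _ assms(2), of uminus]]
  by (simp add: bounded_linear_minus[OF bounded_linear_ident])

lemma Ck_smooth_sum:
  assumes "\<And>i. i \<in> I \<Longrightarrow> Ck_smooth k (f i)"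
  shows "Ck_smooth k (\<lambda>x. \<Sum>i\<in>I. f i x)"
  using assms by (induction I rule: infinite_finite_induct)
    (auto intro!: Ck_smooth_add Ck_smooth_const)

text \<open>The product rule gives two terms of the same bilinear form; in each, one factor is
  differentiated and the other merely gives up one order of smoothness.\<close>

lemma Ck_smooth_bilinear:
  assumes "bounded_bilinear B" "Ck_smooth k f" "Ck_smooth k g"
  shows "Ck_smooth k (\<lambda>x. B (f x) (g x))"
  using assms(2,3)
proof (induction k arbitrary: f g)
  case 0
  then show ?case using bounded_bilinear.continuous_on[OF assms(1)] by auto
next
  case (Suc k)
  show ?case
    by (rule Ck_smooth_SucI[OF bounded_bilinear.FDERIV[OF assms(1) Suc.prems[THEN Ck_smooth_Suc_has_derivative]]],
        rule Ck_smooth_add)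
      (use Suc.IH Suc.prems Suc.prems[THEN Ck_smooth_SucD] in auto)
qed

lemma Ck_smooth_Pair:
  assumes "Ck_smooth k f" "Ck_smooth k g"
  shows "Ck_smooth k (\<lambda>x. (f x, g x))"
proof -
  have "Ck_smooth k (\<lambda>x. (f x, 0) + (0, g x))"
    using assms
    by (intro Ck_smooth_add Ck_smooth_compose_linear[of "\<lambda>z. (z, 0)"]
        Ck_smooth_compose_linear[of "\<lambda>z. (0, z)"] bounded_linear_intros)
  then show ?thesis by simp
qed

text \<open>The sum over \<open>Basis\<close> replaces the operator norm, because
  \<open>Ck_smooth\<close> controls derivatives only along fixed directions.\<close>

lemma linear_norm_bound_Basis:
  fixes D :: "'a::euclidean_space \<Rightarrow> 'b::real_normed_vector"
  assumes "linear D"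
  shows "norm (D v) \<le> (\<Sum>b\<in>Basis. norm (D b)) * norm v"
proof -
  have "D v = D (\<Sum>b\<in>Basis. (v \<bullet> b) *\<^sub>R b)" by (simp add: euclidean_representation)
  also have "\<dots> = (\<Sum>b\<in>Basis. (v \<bullet> b) *\<^sub>R D b)"
    using assms by (simp add: linear_sum linear_cmul)
  also have "norm \<dots> \<le> (\<Sum>b\<in>Basis. norm v * norm (D b))"
    by (rule sum_norm_le) (auto intro!: mult_right_mono Basis_le_norm)
  finally show ?thesis by (simp add: sum_distrib_left mult.commute)
qed

lemma frechet_derivative_Basis_bound:
  fixes f :: "'a::euclidean_space \<Rightarrow> 'b::real_normed_vector"
  assumes "f differentiable (at x)"
  shows "norm (frechet_derivative f (at x) v)
    \<le> (\<Sum>b\<in>Basis. norm (frechet_derivative f (at x) b)) * norm v"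
  by (rule linear_norm_bound_Basis[OF linear_frechet_derivative[OF assms]])

text \<open>The basis sum of the derivative norms is continuous, hence bounded on the compact ball,
  and the mean value inequality turns the bound into a Lipschitz constant.\<close>

lemma C1_locally_lipschitz:
  fixes f :: "'a::euclidean_space \<Rightarrow> 'b::real_normed_vector"
  assumes "Ck_smooth 1 f"
  obtains M where "\<And>x y. \<lbrakk>x \<in> cball z r; y \<in> cball z r\<rbrakk> \<Longrightarrow> norm (f x - f y) \<le> M * norm (x - y)"
proof -
  let ?D = "\<lambda>x. frechet_derivative f (at x)"
  have diff: "f differentiable (at x)" for x using assms by simp
  have "continuous_on (cball z r) (\<lambda>x. \<Sum>b\<in>Basis. norm (?D x b))"
    using assms by (auto intro!: continuous_intros intro: continuous_on_subset)
  then have "bounded ((\<lambda>x. \<Sum>b\<in>Basis. norm (?D x b)) ` cball z r)"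
    by (intro compact_imp_bounded compact_continuous_image) auto
  then obtain M where M: "\<And>x. x \<in> cball z r \<Longrightarrow> (\<Sum>b\<in>Basis. norm (?D x b)) \<le> M"
    unfolding bounded_iff by (metis abs_le_D1 imageI real_norm_def)
  have "norm (f x - f y) \<le> M * norm (x - y)" if "x \<in> cball z r" "y \<in> cball z r" for x y
  proof (rule differentiable_bound[of "cball z r" f ?D])
    show "(f has_derivative ?D x) (at x within cball z r)" for x
      using diff by (metis frechet_derivative_works has_derivative_at_withinI)
    show "onorm (?D x) \<le> M" if "x \<in> cball z r" for x
    proof (rule onorm_le)
      fix v
      have "norm (?D x v) \<le> (\<Sum>b\<in>Basis. norm (?D x b)) * norm v"
        by (rule frechet_derivative_Basis_bound[OF diff])
      also have "\<dots> \<le> M * norm v" using M[OF that] by (intro mult_right_mono) auto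
      finally show "norm (?D x v) \<le> M * norm v" .
    qed
  qed (use that in auto)
  then show thesis using that by blast
qed

text \<open>Each derivative in a basis direction is C^1 and so Lipschitz on the ball; linearity in
  \<open>v\<close> combines these finitely many estimates.\<close>

lemma C2_derivative_locally_lipschitz:
  fixes f :: "'a::euclidean_space \<Rightarrow> 'b::real_normed_vector"
  assumes "Ck_smooth 2 f"
  obtains M where "0 \<le> M"
    "\<And>x y v. \<lbrakk>x \<in> cball z r; y \<in> cball z r\<rbrakk> \<Longrightarrow>
       norm (frechet_derivative f (at x) v - frechet_derivative f (at y) v) \<le> M * norm (x - y) * norm v"
proof -
  let ?D = "\<lambda>x. frechet_derivative f (at x)"
  note diff = Ck_smooth_2_differentiable[OF assms]
  have "Ck_smooth 1 (\<lambda>x. ?D x b)" for b using assms by (simp add: numeral_2_eq_2)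
  then have "\<exists>M. \<forall>x\<in>cball z r. \<forall>y\<in>cball z r. norm (?D x b - ?D y b) \<le> M * norm (x - y)" for b
    by (meson C1_locally_lipschitz)
  then obtain M where M: "\<And>b x y. \<lbrakk>x \<in> cball z r; y \<in> cball z r\<rbrakk> \<Longrightarrow>
      norm (?D x b - ?D y b) \<le> M b * norm (x - y)" by metis
  \<comment> \<open>The individual constants carry no sign; the absolute values supply
    \<open>0 \<le> M\<close>.\<close>
  let ?M = "\<Sum>b\<in>Basis. \<bar>M b\<bar>"
  show thesis
  proof
    show "0 \<le> ?M" by (simp add: sum_nonneg)
    fix x y v assume xy: "x \<in> cball z r" "y \<in> cball z r"
    have "linear (\<lambda>v. ?D x v - ?D y v)"
      using linear_frechet_derivative[OF diff] by (intro linear_compose_sub) auto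
    then have "norm (?D x v - ?D y v) \<le> (\<Sum>b\<in>Basis. norm (?D x b - ?D y b)) * norm v"
      by (rule linear_norm_bound_Basis)
    also have "\<dots> \<le> (\<Sum>b\<in>Basis. \<bar>M b\<bar> * norm (x - y)) * norm v"
      using M[OF xy]
      by (intro sum_mono mult_right_mono) (meson abs_ge_self mult_right_mono norm_ge_zero order_trans, simp)
    finally show "norm (?D x v - ?D y v) \<le> ?M * norm (x - y) * norm v"
      by (simp add: sum_distrib_right)
  qed
qed

text \<open>The expansion point is \<open>x\<close> and the target is the centre \<open>z\<close>,
  which is how a Newton step sees the solution. The mean value inequality along the segment yields
  the constant \<open>M\<close> rather than \<open>M / 2\<close>, which suffices.\<close>

lemma lipschitz_derivative_linearization_error:
  fixes f :: "'a::euclidean_space \<Rightarrow> 'b::real_normed_vector"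
  assumes diff: "\<And>x. f differentiable (at x)"
    and lip: "\<And>x y v. \<lbrakk>x \<in> cball z r; y \<in> cball z r\<rbrakk> \<Longrightarrow>
       norm (frechet_derivative f (at x) v - frechet_derivative f (at y) v) \<le> M * norm (x - y) * norm v"
    and "0 \<le> M" "x \<in> cball z r" "0 \<le> r"
  shows "norm (f z - f x - frechet_derivative f (at x) (z - x)) \<le> M * (norm (x - z))\<^sup>2"
proof -
  let ?D = "\<lambda>x. frechet_derivative f (at x)"
  have seg: "closed_segment x z \<subseteq> cball z r"
    using assms by (intro closed_segment_subset) auto
  have "norm (f z - f x - ?D x (z - x)) \<le> norm (z - x) * (M * norm (x - z))"
  proof (rule differentiable_bound_linearization[where S = "closed_segment x z" and f' = ?D])
    show "x + t *\<^sub>R (z - x) \<in> closed_segment x z" if "t \<in> {0..1}" for t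
      using that by (auto simp: closed_segment_def algebra_simps intro!: exI[of _ t])
    show "(f has_derivative ?D y) (at y within closed_segment x z)" for y
      using diff by (metis frechet_derivative_works has_derivative_at_withinI)
    show "onorm (?D y - ?D x) \<le> M * norm (x - z)" if "y \<in> closed_segment x z" for y
      unfolding fun_diff_def
    proof (rule onorm_le)
      fix v
      have "norm (?D y v - ?D x v) \<le> M * norm (y - x) * norm v"
        using lip seg that assms by auto
      also have "\<dots> \<le> M * norm (x - z) * norm v"
        using \<open>0 \<le> M\<close> segment_bound(1)[OF that]
        by (intro mult_right_mono mult_left_mono) (auto simp: norm_minus_commute)
      finally show "norm (?D y v - ?D x v) \<le> M * norm (x - z) * norm v" .
    qed
  qed auto
  then show ?thesis by (simp add: power2_eq_square norm_minus_commute mult_ac)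
qed

section \<open>Local quadratic convergence of Newton's method\<close>

text \<open>The lower bound \<kappa> of the injective map \<open>\<Phi> wbar\<close> survives as
  \<kappa>/2 at nearby \<open>w\<close>, which keeps \<open>\<Phi> w\<close> invertible. The
  solution \<open>zbar\<close> misses the equation at \<open>w\<close> only by a quadratic residual,
  and dividing by \<kappa>/2 bounds the error.\<close>

lemma newton_equation_estimate:
  fixes \<Phi> :: "'w::real_normed_vector \<Rightarrow> 'u::euclidean_space \<Rightarrow> 'u" and \<rho> :: "'w \<Rightarrow> 'u"
  assumes lin: "\<And>w. linear (\<Phi> w)" and inj: "inj (\<Phi> wbar)"
    and lip: "\<And>w v. w \<in> cball wbar 1 \<Longrightarrow> norm (\<Phi> w v - \<Phi> wbar v) \<le> L * norm (w - wbar) * norm v"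
    and res: "\<And>w. w \<in> cball wbar 1 \<Longrightarrow> norm (\<Phi> w zbar + \<rho> w) \<le> M * (norm (w - wbar))\<^sup>2"
    and "0 \<le> L" "0 \<le> M"
  obtains r \<gamma> where "0 < r" "0 \<le> \<gamma>"
    "\<And>w. norm (w - wbar) < r \<Longrightarrow> bij (\<Phi> w)"
    "\<And>w z. \<lbrakk>norm (w - wbar) < r; \<Phi> w z + \<rho> w = 0\<rbrakk> \<Longrightarrow> norm (z - zbar) \<le> \<gamma> * (norm (w - wbar))\<^sup>2"
proof -
  obtain \<kappa> where \<kappa>: "0 < \<kappa>" "\<And>v. \<kappa> * norm v \<le> norm (\<Phi> wbar v)"
    using linear_inj_bounded_below_pos[OF lin inj] by blast
  \<comment> \<open>The \<open>1\<close> keeps \<open>w\<close> in the ball where \<open>lip\<close>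
    and \<open>res\<close> hold, the other term gives \<open>L * r \<le> \<kappa> / 2\<close>, and
    \<open>L + 1\<close> avoids a division by zero for \<open>L = 0\<close>.\<close>
  define r where "r = min 1 (\<kappa> / (2 * (L + 1)))"
  have r: "0 < r" "r \<le> 1" using \<kappa> \<open>0 \<le> L\<close> by (auto simp: r_def)
  have Lr: "L * r \<le> \<kappa> / 2"
  proof -
    have "L * r \<le> (L + 1) * (\<kappa> / (2 * (L + 1)))"
      using \<open>0 \<le> L\<close> r by (intro mult_mono) (auto simp: r_def)
    also have "\<dots> = \<kappa> / 2" using \<open>0 \<le> L\<close> by (simp add: divide_simps)
    finally show ?thesis .
  qed
  have below: "\<kappa> / 2 * norm v \<le> norm (\<Phi> w v)" if w: "norm (w - wbar) < r" for w v
  proof -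
    have "norm (\<Phi> w v - \<Phi> wbar v) \<le> L * norm (w - wbar) * norm v"
      using w r by (intro lip) (simp add: dist_norm norm_minus_commute)
    also have "\<dots> \<le> L * r * norm v"
      using w \<open>0 \<le> L\<close> by (intro mult_right_mono mult_left_mono) auto
    also have "\<dots> \<le> \<kappa> / 2 * norm v" by (intro mult_right_mono Lr) auto
    finally show ?thesis
      using \<kappa>(2)[of v] norm_triangle_ineq2[of "\<Phi> wbar v" "\<Phi> w v"]
      by (simp add: norm_minus_commute)
  qed
  show thesis
  proof
    show "0 < r" "0 \<le> 2 * M / \<kappa>" using r \<kappa> \<open>0 \<le> M\<close> by auto
    show "bij (\<Phi> w)" if "norm (w - wbar) < r" for w
    proof -
      have "v = 0" if "\<Phi> w v = 0" for v
        using below[OF \<open>norm (w - wbar) < r\<close>, of v] that \<kappa>(1)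
        by (simp add: mult_le_0_iff)
      then have "inj (\<Phi> w)" using lin linear_injective_0 by blast
      then show ?thesis
        using lin linear_injective_imp_surjective by (auto simp: bij_def)
    qed
    show "norm (z - zbar) \<le> 2 * M / \<kappa> * (norm (w - wbar))\<^sup>2"
      if w: "norm (w - wbar) < r" and z: "\<Phi> w z + \<rho> w = 0" for w z
    proof -
      have "\<Phi> w (z - zbar) = - (\<Phi> w zbar + \<rho> w)"
        using z linear_diff[OF lin, of w z zbar] by (simp add: eq_neg_iff_add_eq_0 algebra_simps)
      then have "\<kappa> / 2 * norm (z - zbar) \<le> norm (\<Phi> w zbar + \<rho> w)"
        using below[OF w, of "z - zbar"] by (simp only: norm_minus_cancel)
      also have "\<dots> \<le> M * (norm (w - wbar))\<^sup>2"
        using w r by (intro res) (simp add: dist_norm norm_minus_commute)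
      finally show ?thesis using \<kappa>(1) by (simp add: field_simps)
    qed
  qed
qed

text \<open>Here \<open>eq u z\<close> stands for "\<open>z\<close> is a Newton step from
  \<open>u\<close>", and \<open>p\<close> projects to the components through which the error of a
  step is controlled.\<close>

lemma newton_iteration_converges:
  fixes eq :: "'u::real_normed_vector \<Rightarrow> 'u \<Rightarrow> bool" and p :: "'u \<Rightarrow> 'w::real_normed_vector"
  assumes p: "\<And>u v. norm (p u - p v) \<le> norm (u - v)"
    and "0 < r" "0 \<le> \<gamma>"
    and solvable: "\<And>u. norm (p u - p zbar) < r \<Longrightarrow> \<exists>!z. eq u z"
    and est: "\<And>u z. \<lbrakk>norm (p u - p zbar) < r; eq u z\<rbrakk> \<Longrightarrow>
      norm (z - zbar) \<le> \<gamma> * (norm (p u - p zbar))\<^sup>2"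
    and "open S" "zbar \<in> S"
  obtains U where "open U" "zbar \<in> U" "U \<subseteq> S"
    "\<And>x0. x0 \<in> U \<Longrightarrow> \<exists>!X. X 0 = x0 \<and> (\<forall>k. X k \<in> U) \<and> (\<forall>k. eq (X k) (X (Suc k)))"
    "\<And>X. \<lbrakk>\<And>k. X k \<in> U; \<And>k. eq (X k) (X (Suc k))\<rbrakk> \<Longrightarrow>
       converges_quadratically X zbar \<and> converges_quadratically (\<lambda>k. p (X k)) (p zbar)"
proof -
  obtain \<epsilon> where \<epsilon>: "0 < \<epsilon>" "ball zbar \<epsilon> \<subseteq> S"
    using \<open>open S\<close> \<open>zbar \<in> S\<close> open_contains_ball by blast
  \<comment> \<open>Small enough for solvability, for staying in \<open>S\<close>, and for
    \<open>\<gamma> * \<delta> \<le> 1 / 2\<close>, so that every step at least halves the error and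
    the ball is mapped into itself.\<close>
  define \<delta> where "\<delta> = min (min r \<epsilon>) (1 / (2 * (\<gamma> + 1)))"
  have \<delta>: "0 < \<delta>" "\<delta> \<le> r" "\<delta> \<le> \<epsilon>" using \<open>0 < r\<close> \<open>0 < \<epsilon>\<close> \<open>0 \<le> \<gamma>\<close> by (auto simp: \<delta>_def)
  have \<gamma>\<delta>: "\<gamma> * \<delta> \<le> 1 / 2"
  proof -
    have "\<gamma> * \<delta> \<le> (\<gamma> + 1) * (1 / (2 * (\<gamma> + 1)))"
      using \<open>0 \<le> \<gamma>\<close> \<delta> by (intro mult_mono) (auto simp: \<delta>_def)
    also have "\<dots> = 1 / 2" using \<open>0 \<le> \<gamma>\<close> by (simp add: divide_simps)
    finally show ?thesis .
  qed
  have near: "norm (p u - p zbar) < r" if "u \<in> ball zbar \<delta>" for u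
    using that p[of u zbar] \<delta> by (simp add: dist_norm norm_minus_commute)
  have half: "norm (z - zbar) \<le> norm (u - zbar) / 2" if u: "u \<in> ball zbar \<delta>" and "eq u z" for u z
  proof -
    have "norm (z - zbar) \<le> \<gamma> * (norm (p u - p zbar))\<^sup>2" using est near that by blast
    also have "\<dots> \<le> \<gamma> * (\<delta> * norm (u - zbar))"
      unfolding power2_eq_square
      using u p[of u zbar] \<open>0 \<le> \<gamma>\<close> \<delta>(1) by (intro mult_left_mono mult_mono) (auto simp: dist_norm norm_minus_commute)
    also have "\<dots> = \<gamma> * \<delta> * norm (u - zbar)" by simp
    also have "\<dots> \<le> 1 / 2 * norm (u - zbar)" by (intro mult_right_mono \<gamma>\<delta>) auto
    finally show ?thesis by simp
  qed
  have stays: "z \<in> ball zbar \<delta>" if u: "u \<in> ball zbar \<delta>" and "eq u z" for u z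
    using half[OF that] u norm_ge_zero[of "u - zbar"]
    unfolding mem_ball dist_norm norm_minus_commute[of zbar] by linarith
  show thesis
  proof
    show "open (ball zbar \<delta>)" "zbar \<in> ball zbar \<delta>" "ball zbar \<delta> \<subseteq> S"
      using \<delta> \<epsilon> by auto
    fix x0 assume x0: "x0 \<in> ball zbar \<delta>"
    define N where "N u = (THE z. eq u z)" for u
    have N: "eq u (N u)" if "u \<in> ball zbar \<delta>" for u
      unfolding N_def using solvable[OF near[OF that]] by (rule theI')
    define X where "X k = (N ^^ k) x0" for k
    have XS: "X (Suc k) = N (X k)" for k by (simp add: X_def)
    have XU: "X k \<in> ball zbar \<delta>" for k
    proof (induction k)
      case (Suc k)
      then show ?case unfolding XS using stays N by blast
    qed (simp add: X_def x0[simplified])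
    show "\<exists>!X. X 0 = x0 \<and> (\<forall>k. X k \<in> ball zbar \<delta>) \<and> (\<forall>k. eq (X k) (X (Suc k)))"
    proof (rule ex1I[of _ X])
      show "X 0 = x0 \<and> (\<forall>k. X k \<in> ball zbar \<delta>) \<and> (\<forall>k. eq (X k) (X (Suc k)))"
        using XU N XS by (auto simp: X_def)
      fix Y assume Y: "Y 0 = x0 \<and> (\<forall>k. Y k \<in> ball zbar \<delta>) \<and> (\<forall>k. eq (Y k) (Y (Suc k)))"
      \<comment> \<open>A step from a point of the ball has only one solution in the whole space, so
        induction forces the sequences to agree.\<close>
      have "Y k = X k" for k
      proof (induction k)
        case (Suc k)
        then show ?case using Y N[OF XU[of k]] solvable[OF near[OF XU[of k]]] XS by metis
      qed (use Y X_def in simp)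
      then show "Y = X" by blast
    qed
  next
    fix X assume XU: "\<And>k. X k \<in> ball zbar \<delta>" and X: "\<And>k. eq (X k) (X (Suc k))"
    have geo: "norm (X k - zbar) \<le> (1 / 2) ^ k * \<delta>" for k
    proof (induction k)
      case 0
      then show ?case using XU[of 0] by (simp add: dist_norm norm_minus_commute)
    next
      case (Suc k)
      then have "norm (X (Suc k) - zbar) \<le> (1 / 2) ^ k * \<delta> / 2"
        using half[OF XU X, of k] by linarith
      then show ?case by simp
    qed
    have "(\<lambda>k. (1 / 2) ^ k * \<delta>) \<longlonglongrightarrow> 0 * \<delta>"
      by (intro tendsto_intros LIMSEQ_power_zero) auto
    then have "(\<lambda>k. (1 / 2) ^ k * \<delta>) \<longlonglongrightarrow> 0" by simp
    then have "(\<lambda>k. X k - zbar) \<longlonglongrightarrow> 0"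
      by (rule Lim_null_comparison[rotated]) (intro always_eventually allI geo)
    moreover from tendsto_norm_zero[OF this] have "(\<lambda>k. p (X k) - p zbar) \<longlonglongrightarrow> 0"
      by (rule Lim_null_comparison[rotated]) (intro always_eventually allI p)
    ultimately have lim: "X \<longlonglongrightarrow> zbar" "(\<lambda>k. p (X k)) \<longlonglongrightarrow> p zbar"
      by (auto intro: LIM_zero_cancel)
    \<comment> \<open>Both rates follow from this mixed bound: either the right side is enlarged to
      the full iterate, or the left side is reduced by \<open>p\<close>.\<close>
    have q: "norm (X (Suc k) - zbar) \<le> \<gamma> * (norm (p (X k) - p zbar))\<^sup>2" for k
      by (rule est[OF near[OF XU] X])
    have "norm (X (Suc k) - zbar) \<le> \<gamma> * (norm (X k - zbar))\<^sup>2" for k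
      by (rule order_trans[OF q]) (intro mult_left_mono power_mono p norm_ge_zero \<open>0 \<le> \<gamma>\<close>)
    moreover have "norm (p (X (Suc k)) - p zbar) \<le> \<gamma> * (norm (p (X k) - p zbar))\<^sup>2" for k
      by (rule order_trans[OF p q])
    ultimately show "converges_quadratically X zbar \<and> converges_quadratically (\<lambda>k. p (X k)) (p zbar)"
      unfolding converges_quadratically_def dist_norm
      using lim by blast
  qed
qed

section \<open>Piecewise quadratic convex functions\<close>

text \<open>Real upper bounds, being points of the epigraph, take the place of the values of
  \<open>h\<close>, so that the convex combination is formed in the reals.\<close>

lemma convex_fun_segment:
  assumes "convex_fun h" "h z \<le> ereal r" "h w \<le> ereal q" "0 \<le> t" "t \<le> 1"
  shows "h (z + t *\<^sub>R (w - z)) \<le> ereal (r + t * (q - r))"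
proof -
  have "(1 - t) *\<^sub>R (z, r) + t *\<^sub>R (w, q) \<in> {(z, r). h z \<le> ereal r}"
    using assms unfolding convex_fun_def by (intro convexD) auto
  then show ?thesis by (simp add: algebra_simps)
qed

lemma quadratic_expansion:
  fixes Q :: "real ^ 'n ^ 'n"
  assumes "transpose Q = Q"
  shows "1 / 2 * ((z + t *\<^sub>R d) \<bullet> (Q *v (z + t *\<^sub>R d))) + b \<bullet> (z + t *\<^sub>R d) + \<beta>
    = (1 / 2 * (z \<bullet> (Q *v z)) + b \<bullet> z + \<beta>) + t * ((Q *v z + b) \<bullet> d) + t\<^sup>2 / 2 * (d \<bullet> (Q *v d))"
proof -
  have "z \<bullet> (Q *v d) = d \<bullet> (Q *v z)"
    by (metis assms dot_lmul_matrix inner_commute transpose_matrix_vector)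
  then show ?thesis
    by (simp add: matrix_vector_right_distrib matrix_vector_mult_scaleR inner_add_left inner_add_right
        inner_commute power2_eq_square algebra_simps)
qed

text \<open>Convexity of \<open>h\<close>, tested at the midpoint of the segment, forces the
  curvature of \<open>Q\<close> along \<open>w - z\<close> to be nonnegative; the quadratic then
  lies above its tangent in that direction.\<close>

lemma piece_gradient_inequality:
  fixes Q :: "real ^ 'n ^ 'n"
  assumes "convex_fun h" "convex C" "transpose Q = Q"
    and piece: "\<And>z. z \<in> C \<Longrightarrow> h z = ereal (1 / 2 * (z \<bullet> (Q *v z)) + b \<bullet> z + \<beta>)"
    and "z \<in> C" "w \<in> C"
  shows "h z + ereal ((Q *v z + b) \<bullet> (w - z)) \<le> h w"
proof -
  define q where "q v = 1 / 2 * (v \<bullet> (Q *v v)) + b \<bullet> v + \<beta>" for v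
  define d where "d = w - z"
  have exp: "q (z + t *\<^sub>R d) = q z + t * ((Q *v z + b) \<bullet> d) + t\<^sup>2 / 2 * (d \<bullet> (Q *v d))" for t
    unfolding q_def by (rule quadratic_expansion[OF assms(3)])
  have w: "w = z + 1 *\<^sub>R d" by (simp add: d_def)
  have "z + t *\<^sub>R d \<in> C" if "0 \<le> t" "t \<le> 1" for t
    using convexD_alt[OF \<open>convex C\<close> \<open>z \<in> C\<close> \<open>w \<in> C\<close> that] by (simp add: d_def algebra_simps)
  then have mid: "z + (1 / 2) *\<^sub>R d \<in> C" by simp
  have "h (z + (1 / 2) *\<^sub>R d) \<le> ereal (q z + 1 / 2 * (q w - q z))"
    unfolding d_def using assms by (intro convex_fun_segment) (auto simp: piece q_def)
  then have "q (z + (1 / 2) *\<^sub>R d) \<le> q z + 1 / 2 * (q w - q z)"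
    using piece[OF mid] by (simp add: q_def)
  then have "0 \<le> d \<bullet> (Q *v d)"
    unfolding w exp by (simp add: field_simps power2_eq_square)
  then have "q z + (Q *v z + b) \<bullet> d \<le> q w" unfolding w exp by simp
  then show ?thesis
    using piece[OF \<open>z \<in> C\<close>] piece[OF \<open>w \<in> C\<close>] by (simp add: q_def d_def)
qed

text \<open>Local information becomes global by convexity. A short move from \<open>z\<close>
  towards \<open>w\<close> ends in an active piece, where the gradient inequality and the hypothesis
  on \<open>y\<close> apply; convexity along the segment then carries the subgradient inequality to
  \<open>w\<close>.\<close>

lemma subdifferential_piecewiseI:
  fixes Q :: "nat \<Rightarrow> real ^ 'n ^ 'n"
  assumes h: "convex_fun h" "eff_dom h = (\<Union>k\<in>{1..K}. C k)"
    and C: "\<And>k. k \<in> {1..K} \<Longrightarrow> convex (C k)" "\<And>k. k \<in> {1..K} \<Longrightarrow> closed (C k)"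
    and Q: "\<And>k. k \<in> {1..K} \<Longrightarrow> transpose (Q k) = Q k"
    and piece: "\<And>k z. \<lbrakk>k \<in> {1..K}; z \<in> C k\<rbrakk> \<Longrightarrow>
      h z = ereal (1 / 2 * (z \<bullet> (Q k *v z)) + b k \<bullet> z + \<beta> k)"
    and z: "z \<in> eff_dom h"
    and y: "\<And>k w. \<lbrakk>k \<in> active_pieces K C z; w \<in> C k\<rbrakk> \<Longrightarrow>
      y \<bullet> (w - z) \<le> (Q k *v z + b k) \<bullet> (w - z)"
  shows "y \<in> subdifferential h z"
proof -
  have real: "\<exists>r. h w = ereal r" if "w \<in> eff_dom h" for w
    using that h(2) piece by auto
  obtain r where r: "h z = ereal r" using real z by blast
  \<comment> \<open>The finitely many inactive pieces are closed and miss \<open>z\<close>, so a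
    whole ball around \<open>z\<close> avoids them.\<close>
  let ?N = "\<Union>k\<in>{k\<in>{1..K}. z \<notin> C k}. C k"
  have "closed ?N" using C by (intro closed_UN) auto
  then have "open (- ?N)" by (rule open_Compl)
  then obtain \<delta> where \<delta>: "0 < \<delta>" "ball z \<delta> \<subseteq> - ?N"
    using openE[of "- ?N" z] by blast
  have "h z + ereal (y \<bullet> (w - z)) \<le> h w" for w
  proof (cases "w \<in> eff_dom h")
    case False
    then show ?thesis by (simp add: eff_dom_def)
  next
    case True
    then obtain q where q: "h w = ereal q" using real by blast
    \<comment> \<open>The \<open>1\<close> keeps \<open>v\<close> on the segment, where convexity
      bounds \<open>h v\<close>; the other term puts \<open>v\<close> into the ball, and adding 1 to
      the norm covers \<open>w = z\<close>.\<close>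
    define t where "t = min 1 (\<delta> / (2 * (norm (w - z) + 1)))"
    define v where "v = z + t *\<^sub>R (w - z)"
    have t: "0 < t" "t \<le> 1" using \<delta> by (auto simp: t_def add_pos_nonneg add_nonneg_pos)
    have "t * norm (w - z) \<le> (\<delta> / (2 * (norm (w - z) + 1))) * (norm (w - z) + 1)"
      using t \<delta> by (intro mult_mono) (auto simp: t_def)
    also have "\<dots> = \<delta> / 2" by (simp add: field_simps add_nonneg_eq_0_iff)
    finally have vb: "v \<in> ball z \<delta>" using t \<delta> by (simp add: v_def dist_norm)
    have hv: "h v \<le> ereal (r + t * (q - r))"
      unfolding v_def using h(1) r q t by (intro convex_fun_segment) auto
    then have "v \<in> eff_dom h" by (auto simp: eff_dom_def)
    then obtain k where k: "k \<in> {1..K}" "v \<in> C k" using h(2) by auto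
    have zk: "z \<in> C k"
    proof (rule ccontr)
      assume "z \<notin> C k"
      then have "v \<in> ?N" using k by blast
      then show False using vb \<delta>(2) by blast
    qed
    have grad: "h z + ereal ((Q k *v z + b k) \<bullet> (v - z)) \<le> h v"
      by (rule piece_gradient_inequality[OF h(1) C(1)[OF k(1)] Q[OF k(1)] piece[OF k(1)] zk k(2)])
    have "y \<bullet> (v - z) \<le> (Q k *v z + b k) \<bullet> (v - z)"
      using k zk by (intro y) (auto simp: active_pieces_def)
    then have "h z + ereal (y \<bullet> (v - z)) \<le> h z + ereal ((Q k *v z + b k) \<bullet> (v - z))"
      by (intro add_left_mono) simp
    then have "h z + ereal (y \<bullet> (v - z)) \<le> ereal (r + t * (q - r))"
      using grad hv by (blast intro: order_trans)
    then have "t * (y \<bullet> (w - z)) \<le> t * (q - r)" using r by (simp add: v_def)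
    then show ?thesis using t r q by simp
  qed
  then show ?thesis using z by (simp add: subdifferential_def)
qed

text \<open>Since \<open>Lim\<close> is meaningful only where a limit exists, both limits are
  exhibited: for small positive \<open>t\<close> the quotients equal \<open>p + t / 2 * q\<close>
  and the constant \<open>q\<close>.\<close>

lemma second_dir_deriv_quadratic:
  assumes z: "h z = ereal r"
    and ev: "\<forall>\<^sub>F t in at_right 0. h (z + t *\<^sub>R w) = ereal (r + t * p + t\<^sup>2 / 2 * q)"
  shows "second_dir_deriv h z w = ereal q"
proof -
  have pos: "\<forall>\<^sub>F t in at_right (0::real). 0 < t" by (rule eventually_at_right_less)
  have "((\<lambda>t. ereal (p + t / 2 * q)) \<longlongrightarrow> ereal (p + 0 / 2 * q)) (at_right 0)"
    by (intro tendsto_intros) simp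
  moreover have "\<forall>\<^sub>F t in at_right 0.
      ereal (p + t / 2 * q) = (h (z + t *\<^sub>R w) - h z) / ereal t"
    using ev pos by eventually_elim (simp add: z power2_eq_square field_simps)
  ultimately have "((\<lambda>t. (h (z + t *\<^sub>R w) - h z) / ereal t) \<longlongrightarrow> ereal p) (at_right 0)"
    using tendsto_cong by fastforce
  then have p: "dir_deriv h z w = ereal p"
    unfolding dir_deriv_def by (intro tendsto_Lim) auto
  have "\<forall>\<^sub>F t in at_right 0.
      ereal q = (h (z + t *\<^sub>R w) - h z - ereal t * dir_deriv h z w) / ereal (t\<^sup>2 / 2)"
    using ev pos
  proof eventually_elim
    case (elim t)
    have "0 < s \<Longrightarrow> ereal q = (ereal (r + u + s * q) - ereal r - ereal u) / ereal s" for s u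
      by (simp add: field_simps)
    from this[of "t\<^sup>2 / 2" "t * p"] show ?case
      using elim by (simp only: z p times_ereal.simps) simp
  qed
  then have "((\<lambda>t. (h (z + t *\<^sub>R w) - h z - ereal t * dir_deriv h z w) / ereal (t\<^sup>2 / 2)) \<longlongrightarrow> ereal q) (at_right 0)"
    using tendsto_cong by fastforce
  then show ?thesis unfolding second_dir_deriv_def by (intro tendsto_Lim) auto
qed

section \<open>The optimality system\<close>

lemma sum_scaleR_axis_nth: "(\<Sum>i\<in>UNIV. f i *\<^sub>R axis i (1::real)) $ j = f j"
  by (simp add: axis_def if_distrib cong: if_cong)

text \<open>This expansion uses the derivative only along fixed directions, the form in which the
  smoothness and differentiation rules apply to it.\<close>

lemma transpose_jacobian_mult:
  fixes c :: "real ^ 'n \<Rightarrow> real ^ 'm"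
  shows
  "transpose (jacobian c F) *v y = (\<Sum>i\<in>UNIV. (y \<bullet> frechet_derivative c F (axis i 1)) *\<^sub>R axis i 1)"
  unfolding vec_eq_iff sum_scaleR_axis_nth
  by (simp add: matrix_vector_mult_def transpose_def jacobian_def matrix_def inner_vec_def mult.commute)

lemma jacobian_mult:
  fixes c :: "real ^ 'n \<Rightarrow> real ^ 'm"
  assumes "c differentiable F"
  shows "jacobian c F *v d = frechet_derivative c F d"
  by (simp add: assms jacobian_def linear_frechet_derivative)

lemma gradient_inner:
  fixes c :: "real ^ 'n \<Rightarrow> real ^ 'm"
  assumes "c differentiable (at x)"
  shows "gradient (\<lambda>x. y \<bullet> c x) x = transpose (jacobian c (at x)) *v y"
proof -
  have "((\<lambda>x. y \<bullet> c x) has_derivative (\<lambda>v. y \<bullet> frechet_derivative c (at x) v)) (at x)"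
    using assms by (intro has_derivative_inner_right) (simp add: frechet_derivative_works)
  from frechet_derivative_at[OF this]
  have "frechet_derivative (\<lambda>x. y \<bullet> c x) (at x) = (\<lambda>v. y \<bullet> frechet_derivative c (at x) v)"
    by simp
  then show ?thesis
    unfolding transpose_jacobian_mult vec_eq_iff sum_scaleR_axis_nth by (simp add: gradient_def)
qed

text \<open>The gradient is a basis expansion whose coefficients pair the constant \<open>y\<close>
  with directional derivatives of \<open>c\<close>; it is differentiated term by term.\<close>

lemma hessian_inner_mult:
  fixes c :: "real ^ 'n \<Rightarrow> real ^ 'm"
  assumes "Ck_smooth 2 c"
  shows "hessian (\<lambda>x. y \<bullet> c x) x *v d =
    (\<Sum>i\<in>UNIV. (y \<bullet> frechet_derivative (\<lambda>x. frechet_derivative c (at x) (axis i 1)) (at x) d) *\<^sub>R axis i 1)"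
proof -
  let ?c = "\<lambda>i x. frechet_derivative c (at x) (axis i 1)"
  have c: "c differentiable (at x)" "?c i differentiable (at x)" for i x
    using assms by (simp_all add: numeral_2_eq_2)
  have grad: "gradient (\<lambda>x. y \<bullet> c x) = (\<lambda>x. \<Sum>i\<in>UNIV. (y \<bullet> ?c i x) *\<^sub>R axis i 1)"
    using gradient_inner[OF c(1)] by (simp add: fun_eq_iff transpose_jacobian_mult del: transpose_matrix_vector)
  have "(?c i has_derivative frechet_derivative (?c i) (at x)) (at x)" for i
    using c(2) by (simp add: frechet_derivative_works)
  then have der: "(gradient (\<lambda>x. y \<bullet> c x) has_derivative
      (\<lambda>d. \<Sum>i\<in>UNIV. (y \<bullet> frechet_derivative (?c i) (at x) d) *\<^sub>R axis i 1)) (at x)"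
    unfolding grad
    by (intro has_derivative_sum has_derivative_scaleR_left has_derivative_inner_right)
  then have "gradient (\<lambda>x. y \<bullet> c x) differentiable (at x)" by (rule differentiableI)
  then show ?thesis
    unfolding hessian_def by (simp add: jacobian_mult frechet_derivative_at[OF der, symmetric])
qed

text \<open>The three equation blocks of \<open>g_map\<close> without their multiplier term. They
  depend on \<open>(x, y)\<close> only and contain all the nonlinearity;
  \<open>multiplier_map\<close> restores the rest.\<close>

definition kkt_map ::
  "(real ^ 'n \<Rightarrow> real ^ 'm) \<Rightarrow> real ^ 'm \<Rightarrow> real ^ 'm ^ 'm \<Rightarrow> real ^ 'm \<Rightarrow> real ^ 'l ^ 'm \<Rightarrow>
   (real ^ 'n) \<times> (real ^ 'm) \<Rightarrow> (real ^ 'n) \<times> (real ^ 'm) \<times> (real ^ 'l)" where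
  "kkt_map c cbar Q b A = (\<lambda>(x, y).
     (transpose (jacobian c (at x)) *v y, y - Q *v c x - b, transpose A *v (c x - cbar)))"

definition multiplier_map ::
  "real ^ 'l ^ 'm \<Rightarrow> real ^ 'l \<Rightarrow> (real ^ 'n) \<times> (real ^ 'm) \<times> (real ^ 'l)" where
  "multiplier_map M \<mu> = (0, - (M *v \<mu>), 0)"

lemma bounded_linear_multiplier_map: "bounded_linear (multiplier_map M)"
  unfolding multiplier_map_def
  by (intro bounded_linear_Pair bounded_linear_zero bounded_linear_minus matrix_vector_mul_bounded_linear)

text \<open>One order of smoothness is lost to the Jacobian in the first block. The remaining two
  make the derivative locally Lipschitz, as the quadratic rate requires.\<close>

lemma Ck_smooth_kkt_map:
  fixes c :: "real ^ 'n \<Rightarrow> real ^ 'm"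
  assumes "Ck_smooth 3 c"
  shows "Ck_smooth 2 (kkt_map c cbar Q b A)"
proof -
  have c: "Ck_smooth 2 c" "\<And>v. Ck_smooth 2 (\<lambda>x. frechet_derivative c (at x) v)"
    using assms Ck_smooth_SucD[of 2 c] by (simp_all add: numeral_3_eq_3 numeral_2_eq_2)
  have fst: "Ck_smooth 2 (\<lambda>w. f (fst w))" if "Ck_smooth 2 f" for f :: "real ^ 'n \<Rightarrow> real ^ 'm"
    by (rule Ck_smooth_linear_arg[OF bounded_linear_fst that])
  show ?thesis
    unfolding kkt_map_def case_prod_unfold transpose_jacobian_mult
    by (intro Ck_smooth_Pair Ck_smooth_sum Ck_smooth_compose_linear[OF bounded_linear_scaleR_left]
        Ck_smooth_bilinear[OF bounded_bilinear_inner] Ck_smooth_linear bounded_linear_snd fst c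
        Ck_smooth_diff Ck_smooth_const Ck_smooth_compose_linear[OF matrix_vector_mul_bounded_linear])
qed

text \<open>The product rule splits the first block in two: varying \<open>x\<close> with
  \<open>y\<close> frozen gives the Hessian of the scalar function, and varying \<open>y\<close>
  gives the transposed Jacobian.\<close>

lemma kkt_map_frechet_derivative:
  fixes c :: "real ^ 'n \<Rightarrow> real ^ 'm"
  assumes "Ck_smooth 3 c"
  shows "frechet_derivative (kkt_map c cbar Q b A) (at (x, y)) (d, \<eta>) =
    (hessian (\<lambda>x. y \<bullet> c x) x *v d + transpose (jacobian c (at x)) *v \<eta>,
     \<eta> - Q *v (jacobian c (at x) *v d), transpose A *v (jacobian c (at x) *v d))"
proof -
  let ?c = "\<lambda>i x. frechet_derivative c (at x) (axis i 1)"
  have C2: "Ck_smooth 2 c" using assms Ck_smooth_SucD[of 2 c] by (simp add: numeral_3_eq_3 numeral_2_eq_2)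
  have c: "c differentiable (at x)" "?c i differentiable (at x)" for i x
    using C2 by (simp_all add: numeral_2_eq_2)
  have fst: "((\<lambda>w. f (fst w)) has_derivative (\<lambda>v. f' (fst v))) (at (x, y))"
    if "(f has_derivative f') (at x)" for f :: "real ^ 'n \<Rightarrow> real ^ 'm" and f' and y :: "real ^ 'm"
    using has_derivative_compose[OF bounded_linear_imp_has_derivative[OF bounded_linear_fst], of f f' "(x, y)"]
      that by simp
  have dc: "((\<lambda>w. c (fst w)) has_derivative (\<lambda>v. jacobian c (at x) *v fst v)) (at (x, y))"
    using c(1) by (intro fst) (simp add: jacobian_works)
  have dci: "((\<lambda>w. ?c i (fst w)) has_derivative (\<lambda>v. frechet_derivative (?c i) (at x) (fst v))) (at (x, y))" for i
    using c(2) by (intro fst) (simp add: frechet_derivative_works)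
  have d1: "((\<lambda>w. snd w \<bullet> ?c i (fst w)) has_derivative
      (\<lambda>v. y \<bullet> frechet_derivative (?c i) (at x) (fst v) + snd v \<bullet> ?c i x)) (at (x, y))" for i
    using has_derivative_inner[OF bounded_linear_imp_has_derivative[OF bounded_linear_snd] dci[of i]]
    by simp
  note lin = bounded_linear.has_derivative[OF matrix_vector_mul_bounded_linear]
  have d2: "((\<lambda>w. snd w - Q *v c (fst w) - b) has_derivative
      (\<lambda>v. snd v - Q *v (jacobian c (at x) *v fst v) - 0)) (at (x, y))"
    by (intro has_derivative_diff lin dc has_derivative_const bounded_linear_imp_has_derivative bounded_linear_snd)
  have d3: "((\<lambda>w. transpose A *v (c (fst w) - cbar)) has_derivative
      (\<lambda>v. transpose A *v (jacobian c (at x) *v fst v - 0))) (at (x, y))"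
    by (intro has_derivative_diff lin dc has_derivative_const)
  have "(kkt_map c cbar Q b A has_derivative (\<lambda>v.
      (\<Sum>i\<in>UNIV. (y \<bullet> frechet_derivative (?c i) (at x) (fst v) + snd v \<bullet> ?c i x) *\<^sub>R axis i 1,
       snd v - Q *v (jacobian c (at x) *v fst v) - 0,
       transpose A *v (jacobian c (at x) *v fst v - 0)))) (at (x, y))"
    unfolding kkt_map_def case_prod_unfold transpose_jacobian_mult
    by (intro has_derivative_Pair has_derivative_sum has_derivative_scaleR_left d1 d2 d3)
  from frechet_derivative_at[OF this, symmetric] show ?thesis
    by (simp add: hessian_inner_mult[OF C2] transpose_jacobian_mult scaleR_add_left sum.distrib
        del: transpose_matrix_vector)
qed

section \<open>The linearized inclusion as a linear system with a sign condition\<close>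

definition primal_dual :: "'a \<times> 'b \<times> 'c \<Rightarrow> 'a \<times> 'b" where
  "primal_dual u = (fst u, fst (snd u))"

lemma bounded_linear_primal_dual: "bounded_linear primal_dual"
  unfolding primal_dual_def
  by (intro bounded_linear_Pair bounded_linear_fst bounded_linear_compose[OF bounded_linear_fst bounded_linear_snd])

lemma primal_dual_diff: "primal_dual (u - v) = primal_dual u - primal_dual v"
  by (simp add: primal_dual_def)

lemma norm_primal_dual_le:
  fixes u :: "'a::real_normed_vector \<times> 'b::real_normed_vector \<times> 'c::real_normed_vector"
  shows "norm (primal_dual u) \<le> norm u"
  by (simp add: primal_dual_def norm_prod_def)

lemma g_map_kkt_map:
  "g_map c cbar Q b A P u =
    (case kkt_map c cbar Q b A (primal_dual u) + multiplier_map (A ** P) (snd (snd u)) of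
      (r1, r2, r3) \<Rightarrow> (r1, r2, r3, 0)) + (0, 0, 0, - snd (snd u))"
  by (cases u) (simp add: g_map_def kkt_map_def multiplier_map_def primal_dual_def)

text \<open>The multiplier enters \<open>g_map\<close> linearly, so linearization reproduces its
  contribution exactly: only the multiplier of the new point \<open>z\<close> remains, and the old
  one influences neither the equations nor the sign condition.\<close>

lemma linearized_map_g_map:
  fixes c :: "real ^ 'n \<Rightarrow> real ^ 'm" and cbar b :: "real ^ 'm" and Q :: "real ^ 'm ^ 'm"
    and A :: "real ^ 'l ^ 'm" and P :: "real ^ 'l ^ 'l"
  assumes "Ck_smooth 3 c"
  defines "F \<equiv> kkt_map c cbar Q b A"
  shows "(v1, v2, v3, v4) \<in> linearized_map (g_map c cbar Q b A P) G0_set u z \<longleftrightarrow>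
    F (primal_dual u) + frechet_derivative F (at (primal_dual u)) (primal_dual z - primal_dual u)
      + multiplier_map (A ** P) (snd (snd z)) = (v1, v2, v3) \<and>
    (\<forall>i. 0 \<le> (v4 + snd (snd z)) $ i)"
proof -
  define D where "D = frechet_derivative F (at (primal_dual u))"
  define M :: "real ^ 'l \<Rightarrow> (real ^ 'n) \<times> (real ^ 'm) \<times> (real ^ 'l)" where "M = multiplier_map (A ** P)"
  define \<iota> :: "(real ^ 'n) \<times> (real ^ 'm) \<times> (real ^ 'l) \<Rightarrow> (real ^ 'n) \<times> (real ^ 'm) \<times> (real ^ 'l) \<times> (real ^ 'l)"
    where "\<iota> r = (fst r, fst (snd r), snd (snd r), 0)" for r
  have \<iota>: "bounded_linear \<iota>"
    unfolding \<iota>_def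
    by (intro bounded_linear_Pair bounded_linear_fst bounded_linear_zero
        bounded_linear_compose[OF bounded_linear_fst bounded_linear_snd]
        bounded_linear_compose[OF bounded_linear_snd bounded_linear_snd])
  have q: "bounded_linear (\<lambda>u. snd (snd u))"
    by (rule bounded_linear_compose[OF bounded_linear_snd bounded_linear_snd])
  have M: "bounded_linear M" unfolding M_def by (rule bounded_linear_multiplier_map)
  have g: "g_map c cbar Q b A P = (\<lambda>u. \<iota> (F (primal_dual u) + M (snd (snd u))) + (0, 0, 0, - snd (snd u)))"
    by (simp add: g_map_kkt_map F_def M_def \<iota>_def fun_eq_iff case_prod_unfold)
  have "Ck_smooth 2 F" unfolding F_def by (rule Ck_smooth_kkt_map[OF assms(1)])
  then have "F differentiable (at (primal_dual u))" by (rule Ck_smooth_2_differentiable)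
  then have FD: "(F has_derivative D) (at (primal_dual u))"
    unfolding D_def by (simp add: frechet_derivative_works)
  have tail: "bounded_linear (\<lambda>u :: (real ^ 'n) \<times> (real ^ 'm) \<times> (real ^ 'l). (0 :: real ^ 'n, 0 :: real ^ 'm, 0 :: real ^ 'l, - snd (snd u)))"
    by (intro bounded_linear_Pair bounded_linear_zero bounded_linear_minus q)
  have "(g_map c cbar Q b A P has_derivative
      (\<lambda>v. \<iota> (D (primal_dual v) + M (snd (snd v))) + (0, 0, 0, - snd (snd v)))) (at u)"
    unfolding g
    by (intro has_derivative_add bounded_linear.has_derivative[OF \<iota>] bounded_linear.has_derivative[OF M]
        has_derivative_compose[OF bounded_linear_imp_has_derivative[OF bounded_linear_primal_dual] FD]
        bounded_linear_imp_has_derivative[OF q] bounded_linear_imp_has_derivative[OF tail])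
  from frechet_derivative_at[OF this, symmetric]
  have G: "frechet_derivative (g_map c cbar Q b A P) (at u) (z - u) =
      \<iota> (D (primal_dual z - primal_dual u) + M (snd (snd z) - snd (snd u))) + (0, 0, 0, - (snd (snd z) - snd (snd u)))"
    by (simp add: primal_dual_diff)
  define r where "r = F (primal_dual u) + D (primal_dual z - primal_dual u) + M (snd (snd z))"
  have M': "M (snd (snd z) - snd (snd u)) = M (snd (snd z)) - M (snd (snd u))"
    by (rule linear_diff[OF bounded_linear.linear[OF M]])
  \<comment> \<open>The multiplier terms at \<open>u\<close> in the value and in the derivative
    cancel.\<close>
  have "g_map c cbar Q b A P u + frechet_derivative (g_map c cbar Q b A P) (at u) (z - u)
      = \<iota> r + (0, 0, 0, - snd (snd z))"
    unfolding G M' by (simp add: g r_def \<iota>_def)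
  then have "(v1, v2, v3, v4) \<in> linearized_map (g_map c cbar Q b A P) G0_set u z \<longleftrightarrow>
      (\<exists>p. (\<forall>i. 0 \<le> p $ i) \<and> (v1, v2, v3, v4) = \<iota> r + (0, 0, 0, - snd (snd z)) + (0, 0, 0, p))"
    unfolding linearized_map_def G0_set_def by auto
  also have "\<dots> \<longleftrightarrow> r = (v1, v2, v3) \<and> (\<forall>i. 0 \<le> (v4 + snd (snd z)) $ i)"
  proof (cases r)
    case (fields r1 r2 r3)
    \<comment> \<open>The only possible slack is \<open>p = v4 + snd (snd z)\<close>, so membership
      in the cone becomes a sign condition.\<close>
    have "(\<exists>p. (\<forall>i. 0 \<le> p $ i) \<and> v4 = p - snd (snd z)) \<longleftrightarrow> (\<forall>i. 0 \<le> (v4 + snd (snd z)) $ i)"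
      by (metis add_diff_cancel_right' diff_add_cancel)
    then show ?thesis by (auto simp: fields \<iota>_def)
  qed
  finally show ?thesis by (simp add: r_def D_def M_def)
qed

text \<open>Both conclusions are reduced to one affine system, nonsingular by \<open>inj\<close>;
  \<open>pos\<close> makes the sign condition hold strictly near the solution.\<close>

lemma kkt_newton_regularity:
  fixes c :: "real ^ 'n \<Rightarrow> real ^ 'm" and A :: "real ^ 'l ^ 'm" and P :: "real ^ 'l ^ 'l"
  assumes c: "Ck_smooth 3 c"
    and root: "kkt_map c cbar Q b A (xbar, ybar) + multiplier_map (A ** P) mubar = 0"
    and pos: "\<And>i. 0 < mubar $ i"
    and inj: "\<And>d \<eta> \<nu>. frechet_derivative (kkt_map c cbar Q b A) (at (xbar, ybar)) (d, \<eta>)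
       + multiplier_map (A ** P) \<nu> = 0 \<Longrightarrow> d = 0 \<and> \<eta> = 0 \<and> \<nu> = 0"
  shows "strongly_metrically_regular
      (linearized_map (g_map c cbar Q b A P) G0_set (xbar, ybar, mubar)) (xbar, ybar, mubar) 0"
    and "\<exists>U. open U \<and> (xbar, ybar, mubar) \<in> U \<and>
      (\<forall>x0\<in>U.
         (\<exists>!X. X 0 = x0 \<and> (\<forall>k. X k \<in> U) \<and> newton_sequence (g_map c cbar Q b A P) G0_set X) \<and>
         (\<forall>X. X 0 = x0 \<and> (\<forall>k. X k \<in> U) \<and> newton_sequence (g_map c cbar Q b A P) G0_set X \<longrightarrow>
            converges_quadratically X (xbar, ybar, mubar) \<and>
            converges_quadratically (\<lambda>k. (fst (X k), fst (snd (X k)))) (xbar, ybar)))"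
proof -
  define F where "F = kkt_map c cbar Q b A"
  define g where "g = g_map c cbar Q b A P"
  define wbar where "wbar = (xbar, ybar)"
  define zbar where "zbar = (xbar, ybar, mubar)"
  define B :: "real ^ 'l \<Rightarrow> (real ^ 'n) \<times> (real ^ 'm) \<times> (real ^ 'l)" where "B = multiplier_map (A ** P)"
  let ?D = "\<lambda>w. frechet_derivative F (at w)"
  \<comment> \<open>Linear part and constant term of the Newton equation based at
    \<open>w = (x, y)\<close>; the multiplier of the base point does not occur.\<close>
  define \<Phi> where "\<Phi> w z = ?D w (primal_dual z) + B (snd (snd z))" for w z
  define \<rho> where "\<rho> w = F w - ?D w w" for w
  have pz: "primal_dual zbar = wbar" by (simp add: zbar_def wbar_def primal_dual_def)
  have F2: "Ck_smooth 2 F" unfolding F_def by (rule Ck_smooth_kkt_map[OF c])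
  note diff = Ck_smooth_2_differentiable[OF F2]
  have Dlin: "linear (?D w)" for w by (rule linear_frechet_derivative[OF diff])
  have B: "linear B" unfolding B_def by (rule bounded_linear.linear[OF bounded_linear_multiplier_map])
  note pd = bounded_linear.linear[OF bounded_linear_primal_dual]
  have \<Phi>lin: "linear (\<Phi> w)" for w
    by (rule linearI)
      (simp_all add: \<Phi>_def linear_add[OF pd] linear_cmul[OF pd] linear_add[OF Dlin] linear_cmul[OF Dlin]
        linear_add[OF B] linear_cmul[OF B] scaleR_add_right)
  have step: "(v1, v2, v3, v4) \<in> linearized_map g G0_set u z \<longleftrightarrow>
      \<Phi> (primal_dual u) z + \<rho> (primal_dual u) = (v1, v2, v3) \<and> (\<forall>i. 0 \<le> (v4 + snd (snd z)) $ i)"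
    for v1 v2 v3 v4 u z
    unfolding g_def linearized_map_g_map[OF c] F_def[symmetric] B_def[symmetric] \<Phi>_def \<rho>_def linear_diff[OF Dlin]
    by (simp add: algebra_simps)
  have \<Phi>inj: "inj (\<Phi> wbar)"
    unfolding linear_injective_0[OF \<Phi>lin]
  proof (intro allI impI)
    fix z assume "\<Phi> wbar z = 0"
    then show "z = 0"
      using inj[of "fst z" "fst (snd z)" "snd (snd z)"]
      by (cases z) (auto simp: \<Phi>_def F_def B_def wbar_def primal_dual_def zero_prod_def)
  qed
  obtain L where L: "0 \<le> L" "\<And>x y v. \<lbrakk>x \<in> cball wbar 1; y \<in> cball wbar 1\<rbrakk> \<Longrightarrow>
      norm (?D x v - ?D y v) \<le> L * norm (x - y) * norm v"
    using C2_derivative_locally_lipschitz[OF F2, of wbar 1] by metis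
  have lip: "norm (\<Phi> w v - \<Phi> wbar v) \<le> L * norm (w - wbar) * norm v" if "w \<in> cball wbar 1" for w v
  proof -
    have "norm (\<Phi> w v - \<Phi> wbar v) \<le> L * norm (w - wbar) * norm (primal_dual v)"
      using L(2)[OF that, of wbar] by (simp add: \<Phi>_def)
    also have "\<dots> \<le> L * norm (w - wbar) * norm v"
      using \<open>0 \<le> L\<close> by (intro mult_left_mono norm_primal_dual_le) simp
    finally show ?thesis .
  qed
  \<comment> \<open>Because \<open>F wbar + B mubar = 0\<close>, the residual of \<open>zbar\<close>
    is, up to sign, the linearization error of \<open>F\<close> at \<open>w\<close> evaluated at
    \<open>wbar\<close>.\<close>
  have res: "norm (\<Phi> w zbar + \<rho> w) \<le> L * (norm (w - wbar))\<^sup>2" if "w \<in> cball wbar 1" for w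
  proof -
    have "F wbar + B mubar = 0" using root by (simp add: F_def B_def wbar_def)
    then have "\<Phi> w zbar + \<rho> w = - (F wbar - F w - ?D w (wbar - w))"
      unfolding \<Phi>_def \<rho>_def pz linear_diff[OF Dlin]
      by (simp add: zbar_def eq_neg_iff_add_eq_0 add.commute)
    then show ?thesis
      using lipschitz_derivative_linearization_error[OF diff L(2) \<open>0 \<le> L\<close> that] by (simp add: norm_minus_commute)
  qed
  obtain r \<gamma> where r: "0 < r" "0 \<le> \<gamma>"
    and bij: "\<And>w. norm (w - wbar) < r \<Longrightarrow> bij (\<Phi> w)"
    and est: "\<And>w z. \<lbrakk>norm (w - wbar) < r; \<Phi> w z + \<rho> w = 0\<rbrakk> \<Longrightarrow> norm (z - zbar) \<le> \<gamma> * (norm (w - wbar))\<^sup>2"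
    using newton_equation_estimate[OF \<Phi>lin \<Phi>inj lip res \<open>0 \<le> L\<close> \<open>0 \<le> L\<close>] by metis
  let ?S = "{z :: (real ^ 'n) \<times> (real ^ 'm) \<times> (real ^ 'l). \<forall>i. 0 < snd (snd z) $ i}"
  have "open (\<Inter>i\<in>UNIV. {z :: (real ^ 'n) \<times> (real ^ 'm) \<times> (real ^ 'l). 0 < snd (snd z) $ i})"
    by (intro open_INT open_Collect_less continuous_intros ballI) auto
  moreover have "(\<Inter>i\<in>UNIV. {z :: (real ^ 'n) \<times> (real ^ 'm) \<times> (real ^ 'l). 0 < snd (snd z) $ i}) = ?S"
    by auto
  ultimately have S: "open ?S" "zbar \<in> ?S" using pos by (auto simp: zbar_def)

  \<comment> \<open>Strong metric regularity\<close>
  define \<Psi> where "\<Psi> = inv (\<Phi> wbar)"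
  have bij0: "bij (\<Phi> wbar)" using bij[of wbar] r by simp
  have \<Psi>: "\<Phi> wbar (\<Psi> v) = v" "\<Psi> (\<Phi> wbar z) = z" for v z
    using bij0 by (simp_all add: \<Psi>_def bij_is_surj surj_f_inv_f bij_is_inj inv_f_f)
  have "linear \<Psi>"
    by (rule linearI; rule inv_into_f_eq[of "\<Phi> wbar" UNIV, folded \<Psi>_def])
      (use bij0 in \<open>auto simp: bij_is_inj linear_add[OF \<Phi>lin] linear_cmul[OF \<Phi>lin] \<Psi>\<close>)
  then have \<Psi>bl: "bounded_linear \<Psi>" by (simp add: linear_conv_bounded_linear)
  \<comment> \<open>Solves the three equation blocks for a perturbation \<open>v\<close>. It is
    affine in \<open>v\<close>, hence Lipschitz on every set.\<close>
  define \<sigma> where "\<sigma> v = \<Psi> ((fst v, fst (snd v), fst (snd (snd v))) - \<rho> wbar)"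
    for v :: "(real ^ 'n) \<times> (real ^ 'm) \<times> (real ^ 'l) \<times> (real ^ 'l)"
  have \<pi>: "bounded_linear (\<lambda>v :: (real ^ 'n) \<times> (real ^ 'm) \<times> (real ^ 'l) \<times> (real ^ 'l).
      (fst v, fst (snd v), fst (snd (snd v))))"
    by (intro bounded_linear_Pair bounded_linear_fst bounded_linear_compose[OF bounded_linear_fst]
        bounded_linear_compose[OF bounded_linear_snd] bounded_linear_snd)
  obtain K where K: "\<And>v :: (real ^ 'n) \<times> (real ^ 'm) \<times> (real ^ 'l) \<times> (real ^ 'l).
      norm (\<Psi> (fst v, fst (snd v), fst (snd (snd v)))) \<le> norm v * K"
    and "0 \<le> K"
    using bounded_linear.nonneg_bounded[OF bounded_linear_compose[OF \<Psi>bl \<pi>]] by metis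
  have \<sigma>diff: "\<sigma> v - \<sigma> w = \<Psi> (fst (v - w), fst (snd (v - w)), fst (snd (snd (v - w))))" for v w
    unfolding \<sigma>_def linear_diff[OF \<open>linear \<Psi>\<close>, symmetric] by simp
  have lipschitz: "K-lipschitz_on V \<sigma>" for V
    using K \<open>0 \<le> K\<close> by (intro lipschitz_onI) (simp_all only: dist_norm \<sigma>diff mult.commute)
  have "\<Phi> wbar zbar + \<rho> wbar = 0" using res[of wbar] by simp
  then have \<sigma>0: "\<sigma> 0 = zbar"
    using \<Psi>(2)[of zbar] by (simp add: \<sigma>_def eq_neg_iff_add_eq_0[symmetric] flip: zero_prod_def)
  \<comment> \<open>For these perturbations \<open>\<sigma> v\<close> meets the sign condition
    strictly; openness follows from continuity of \<sigma>.\<close>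
  let ?V = "{v. \<forall>i. 0 < (snd (snd (snd v)) + snd (snd (\<sigma> v))) $ i}"
  have "continuous_on UNIV \<sigma>" using lipschitz lipschitz_on_continuous_on by blast
  then have "open (\<Inter>i\<in>UNIV. {v. 0 < (snd (snd (snd v)) + snd (snd (\<sigma> v))) $ i})"
    by (intro open_INT open_Collect_less continuous_intros ballI) auto
  moreover have "(\<Inter>i\<in>UNIV. {v. 0 < (snd (snd (snd v)) + snd (snd (\<sigma> v))) $ i}) = ?V" by auto
  ultimately have V: "open ?V" "0 \<in> ?V" using pos \<sigma>0 by (auto simp: zbar_def)
  have sol: "v \<in> linearized_map g G0_set zbar z \<longleftrightarrow>
      z = \<sigma> v \<and> (\<forall>i. 0 \<le> (snd (snd (snd v)) + snd (snd z)) $ i)" for v z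
  proof -
    obtain v1 v2 v3 v4 where v: "v = (v1, v2, v3, v4)" by (metis prod_cases4)
    have "\<Phi> wbar z + \<rho> wbar = (v1, v2, v3) \<longleftrightarrow> z = \<sigma> v"
      unfolding v \<sigma>_def using \<Psi> by (metis add_diff_cancel_right' diff_add_cancel fst_conv snd_conv)
    then show ?thesis by (simp add: v step pz)
  qed
  \<comment> \<open>The equations alone determine \<open>z\<close>, so the localization needs no
    restriction in the solution space and \<open>UNIV\<close> serves as its neighbourhood.\<close>
  have "{z. v \<in> linearized_map g G0_set zbar z} \<inter> UNIV = {\<sigma> v}" if "v \<in> ?V" for v
    using that by (auto simp: sol less_imp_le)
  moreover have "0 \<in> linearized_map g G0_set zbar zbar"
    using sol[of 0 zbar] \<sigma>0 pos by (simp add: zbar_def less_imp_le)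
  ultimately have "strongly_metrically_regular (linearized_map g G0_set zbar) zbar 0"
    unfolding strongly_metrically_regular_def using V lipschitz open_UNIV UNIV_I by blast
  then show "strongly_metrically_regular
      (linearized_map (g_map c cbar Q b A P) G0_set (xbar, ybar, mubar)) (xbar, ybar, mubar) 0"
    by (simp add: g_def zbar_def)

  \<comment> \<open>Convergence of Newton's method\<close>
  define E where "E u z \<longleftrightarrow> \<Phi> (primal_dual u) z + \<rho> (primal_dual u) = 0"
    for u z :: "(real ^ 'n) \<times> (real ^ 'm) \<times> (real ^ 'l)"
  have solvable: "\<exists>!z. E u z" if "norm (primal_dual u - primal_dual zbar) < r" for u
  proof -
    have "bij (\<Phi> (primal_dual u))" using bij that pz by simp
    then have "\<exists>!z. \<Phi> (primal_dual u) z = - \<rho> (primal_dual u)" by (metis bij_pointE)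
    then show ?thesis by (simp add: E_def eq_neg_iff_add_eq_0)
  qed
  have estE: "norm (z - zbar) \<le> \<gamma> * (norm (primal_dual u - primal_dual zbar))\<^sup>2"
    if "norm (primal_dual u - primal_dual zbar) < r" "E u z" for u z
    using est that unfolding E_def pz by blast
  obtain U where U: "open U" "zbar \<in> U" "U \<subseteq> ?S"
    and ex: "\<And>x0. x0 \<in> U \<Longrightarrow> \<exists>!X. X 0 = x0 \<and> (\<forall>k. X k \<in> U) \<and> (\<forall>k. E (X k) (X (Suc k)))"
    and conv: "\<And>X. \<lbrakk>\<And>k. X k \<in> U; \<And>k. E (X k) (X (Suc k))\<rbrakk> \<Longrightarrow>
       converges_quadratically X zbar \<and> converges_quadratically (\<lambda>k. primal_dual (X k)) (primal_dual zbar)"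
    using newton_iteration_converges[where eq = E, OF norm_primal_dual_le[of "_ - _", unfolded primal_dual_diff] r solvable estE S] by blast
  \<comment> \<open>\<open>E\<close> omits the sign condition. All points of \<open>U\<close> have
    positive multipliers, so for sequences confined to \<open>U\<close> the equation and the
    inclusion coincide.\<close>
  have newton: "(\<forall>k. X k \<in> U) \<and> newton_sequence g G0_set X \<longleftrightarrow>
      (\<forall>k. X k \<in> U) \<and> (\<forall>k. E (X k) (X (Suc k)))" for X
  proof -
    have "0 \<in> linearized_map g G0_set (X k) (X (Suc k)) \<longleftrightarrow> E (X k) (X (Suc k))" if "\<forall>k. X k \<in> U" for k
    proof -
      have "X (Suc k) \<in> ?S" using that U(3) by blast
      then show ?thesis using step[of 0 0 0 0 "X k" "X (Suc k)"]
        by (auto simp: E_def less_imp_le zero_prod_def)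
    qed
    then show ?thesis by (auto simp: newton_sequence_def)
  qed
  have "\<forall>x0\<in>U.
         (\<exists>!X. X 0 = x0 \<and> (\<forall>k. X k \<in> U) \<and> newton_sequence g G0_set X) \<and>
         (\<forall>X. X 0 = x0 \<and> (\<forall>k. X k \<in> U) \<and> newton_sequence g G0_set X \<longrightarrow>
            converges_quadratically X zbar \<and>
            converges_quadratically (\<lambda>k. (fst (X k), fst (snd (X k)))) wbar)"
    unfolding newton using ex conv[unfolded pz] by (simp add: primal_dual_def)
  then show "\<exists>U. open U \<and> (xbar, ybar, mubar) \<in> U \<and>
      (\<forall>x0\<in>U.
         (\<exists>!X. X 0 = x0 \<and> (\<forall>k. X k \<in> U) \<and> newton_sequence (g_map c cbar Q b A P) G0_set X) \<and>
         (\<forall>X. X 0 = x0 \<and> (\<forall>k. X k \<in> U) \<and> newton_sequence (g_map c cbar Q b A P) G0_set X \<longrightarrow>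
            converges_quadratically X (xbar, ybar, mubar) \<and>
            converges_quadratically (\<lambda>k. (fst (X k), fst (snd (X k)))) (xbar, ybar)))"
    using U(1,2) unfolding g_def zbar_def wbar_def by blast
qed

section \<open>Signed columns, polyhedra and relative interiors\<close>

lemma transpose_mult_nth: "(transpose A *v w) $ r = column r A \<bullet> w"
  for A :: "real ^ 'l ^ 'm"
  by (simp add: matrix_vector_mult_def transpose_def column_def inner_vec_def del: transpose_matrix_vector)

lemma matrix_vector_inner_columns: "(M *v \<mu>) \<bullet> v = (\<Sum>r\<in>UNIV. \<mu> $ r * (column r M \<bullet> v))"
  for M :: "real ^ 'l ^ 'm"
proof -
  have "(M *v \<mu>) \<bullet> v = \<mu> \<bullet> (transpose M *v v)"
    by (metis dot_lmul_matrix inner_commute transpose_matrix_vector)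
  then show ?thesis by (simp add: inner_vec_def[of \<mu>] transpose_mult_nth del: transpose_matrix_vector)
qed

text \<open>The squares of the signs are 1. This allows a combination of columns signed for one
  piece to be rewritten with the signs of any other active piece.\<close>

lemma diagonal_sign_matrix_involution:
  fixes P :: "real ^ 'l ^ 'l"
  assumes "\<And>p r. p \<noteq> r \<Longrightarrow> P $ p $ r = 0" "\<And>r. P $ r $ r \<in> {1, -1}"
  shows "P *v (P *v v) = v"
proof -
  have "(P *v v) $ r = P $ r $ r * v $ r" for v r
  proof -
    have "(\<Sum>p\<in>UNIV. P $ r $ p * v $ p) = (\<Sum>p\<in>{r}. P $ r $ p * v $ p)"
      using assms(1) by (intro sum.mono_neutral_right) auto
    then show ?thesis by (simp add: matrix_vector_mult_def)
  qed
  moreover have "P $ r $ r * P $ r $ r = 1" for r using assms(2)[of r] by auto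
  ultimately show ?thesis by (simp add: vec_eq_iff flip: mult.assoc)
qed

text \<open>Constraints active at \<open>z\<close> stay equalities along \<open>w\<close>, inactive
  ones stay strict for small \<open>t\<close> by continuity, and there are finitely many.\<close>

lemma eventually_in_polyhedron:
  fixes a :: "nat \<Rightarrow> 'a::real_inner"
  assumes C: "C = {z. \<forall>j\<in>J. (\<omega> j *\<^sub>R a j) \<bullet> z \<le> \<omega> j * \<alpha> j}" and "finite J" "z \<in> C"
    and sign: "\<And>j. j \<in> J \<Longrightarrow> \<omega> j \<noteq> 0"
    and w: "\<And>j. \<lbrakk>j \<in> J; a j \<bullet> z = \<alpha> j\<rbrakk> \<Longrightarrow> a j \<bullet> w = 0"
  shows "\<forall>\<^sub>F t in at_right 0. z + t *\<^sub>R w \<in> C"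
proof -
  have "\<forall>\<^sub>F t in at_right 0. (\<omega> j *\<^sub>R a j) \<bullet> (z + t *\<^sub>R w) \<le> \<omega> j * \<alpha> j" if j: "j \<in> J" for j
  proof (cases "a j \<bullet> z = \<alpha> j")
    case True
    then show ?thesis using w[OF j] by (simp add: inner_add_right)
  next
    case False
    then have "(\<omega> j *\<^sub>R a j) \<bullet> z < \<omega> j * \<alpha> j"
      using \<open>z \<in> C\<close> sign[OF j] j by (force simp: C less_le)
    moreover have "((\<lambda>t. (\<omega> j *\<^sub>R a j) \<bullet> (z + t *\<^sub>R w)) \<longlongrightarrow> (\<omega> j *\<^sub>R a j) \<bullet> (z + 0 *\<^sub>R w)) (at_right 0)"
      by (intro tendsto_intros)
    ultimately show ?thesis by (auto elim: eventually_mono dest!: order_tendstoD(2))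
  qed
  then have "\<forall>\<^sub>F t in at_right 0. \<forall>j\<in>J. (\<omega> j *\<^sub>R a j) \<bullet> (z + t *\<^sub>R w) \<le> \<omega> j * \<alpha> j"
    using \<open>finite J\<close> by (intro eventually_ball_finite) auto
  then show ?thesis by (simp add: C)
qed

text \<open>Since \<open>D\<close> contains both \<open>y\<close> and
  \<open>y + \<epsilon> *\<^sub>R v\<close>, the direction \<open>v\<close> is parallel to its
  affine hull; a shorter move then stays in the relative interior.\<close>

lemma rel_interior_move:
  fixes y v :: "'a::euclidean_space"
  assumes y: "y \<in> rel_interior D" and "0 < \<epsilon>" "y + \<epsilon> *\<^sub>R v \<in> D"
  obtains t where "0 < t" "y + t *\<^sub>R v \<in> rel_interior D"
proof -
  obtain e where e: "0 < e" "ball y e \<inter> affine hull D \<subseteq> rel_interior D"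
    using openin_rel_interior[of D] y unfolding openin_contains_ball by blast
  define t where "t = e / (2 * (norm v + 1))"
  have "0 < t" using e by (simp add: t_def add_nonneg_pos)
  have "t * norm v < e"
  proof -
    have "t * norm v \<le> t * (norm v + 1)" using \<open>0 < t\<close> by simp
    also have "\<dots> = e / 2" by (simp add: t_def add_nonneg_eq_0_iff field_simps)
    finally show ?thesis using e by simp
  qed
  then have "y + t *\<^sub>R v \<in> ball y e" using \<open>0 < t\<close> by (simp add: dist_norm)
  moreover have "y + t *\<^sub>R v \<in> affine hull D"
  proof -
    have "(1 - t / \<epsilon>) *\<^sub>R y + (t / \<epsilon>) *\<^sub>R (y + \<epsilon> *\<^sub>R v) \<in> affine hull D"
      using assms rel_interior_subset by (intro mem_affine[OF affine_affine_hull]) (auto intro: hull_inc)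
    also have "(1 - t / \<epsilon>) *\<^sub>R y + (t / \<epsilon>) *\<^sub>R (y + \<epsilon> *\<^sub>R v) = y + t *\<^sub>R v"
      using \<open>0 < \<epsilon>\<close> by (simp add: algebra_simps)
    finally show ?thesis .
  qed
  ultimately show thesis using e that \<open>0 < t\<close> by blast
qed

text \<open>Pairing equation \<open>1\<close> with \<open>d\<close> and inserting \<eta> from
  \<open>2\<close> leaves exactly the form in \<open>so\<close>, as the term with \<open>A\<close>
  vanishes by \<open>3\<close>. Hence \<open>d = 0\<close>, and \<open>nd\<close> handles the
  remaining multiplier.\<close>

lemma kkt_system_injective:
  fixes H :: "real ^ 'n ^ 'n" and J :: "real ^ 'n ^ 'm" and Q :: "real ^ 'm ^ 'm"
    and A :: "real ^ 'l ^ 'm" and P :: "real ^ 'l ^ 'l"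
  assumes so: "\<And>d. \<lbrakk>transpose A *v (J *v d) = 0; d \<noteq> 0\<rbrakk> \<Longrightarrow>
      0 < (J *v d) \<bullet> (Q *v (J *v d)) + d \<bullet> (H *v d)"
    and nd: "\<And>\<nu>. transpose J *v ((A ** P) *v \<nu>) = 0 \<Longrightarrow> \<nu> = 0"
    and 1: "H *v d + transpose J *v \<eta> = 0"
    and 2: "\<eta> - Q *v (J *v d) - (A ** P) *v \<nu> = 0"
    and 3: "transpose A *v (J *v d) = 0"
  shows "d = 0 \<and> \<eta> = 0 \<and> \<nu> = 0"
proof -
  have \<eta>: "\<eta> = Q *v (J *v d) + A *v (P *v \<nu>)"
    using 2 by (simp add: matrix_vector_mul_assoc algebra_simps)
  have "H *v d = - (transpose J *v \<eta>)" using 1 by (simp add: eq_neg_iff_add_eq_0 del: transpose_matrix_vector)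
  then have "d \<bullet> (H *v d) = - (d \<bullet> (transpose J *v \<eta>))" by simp
  also have "d \<bullet> (transpose J *v \<eta>) = (J *v d) \<bullet> \<eta>"
    by (simp add: dot_lmul_matrix inner_commute[of d] inner_commute[of _ \<eta>])
  also have "\<dots> = (J *v d) \<bullet> (Q *v (J *v d)) + (transpose A *v (J *v d)) \<bullet> (P *v \<nu>)"
    unfolding \<eta> by (simp add: inner_add_right dot_lmul_matrix)
  finally have "(J *v d) \<bullet> (Q *v (J *v d)) + d \<bullet> (H *v d) = 0" unfolding 3 by simp
  then have d: "d = 0" using so[OF 3] by fastforce
  then have \<eta>': "\<eta> = (A ** P) *v \<nu>" using 2 by simp
  have "transpose J *v \<eta> = 0" using 1 d by simp
  then have "\<nu> = 0" unfolding \<eta>' by (rule nd)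
  then show ?thesis using d \<eta>' by simp
qed

theorem theorem7p1:
  fixes h :: "real ^ 'm \<Rightarrow> ereal"
    and K s :: nat
    and C :: "nat \<Rightarrow> (real ^ 'm) set"
    and Q :: "nat \<Rightarrow> real ^ 'm ^ 'm"
    and b :: "nat \<Rightarrow> real ^ 'm"
    and \<beta> :: "nat \<Rightarrow> real"
    and a :: "nat \<Rightarrow> real ^ 'm"
    and \<alpha> :: "nat \<Rightarrow> real"
    and \<omega> :: "nat \<Rightarrow> nat \<Rightarrow> real"
    and c :: "real ^ 'n \<Rightarrow> real ^ 'm"
    and xbar :: "real ^ 'n"
    and cbar ybar :: "real ^ 'm"
    and kbar :: nat
    and kk :: "nat \<Rightarrow> nat"
    and e :: "'l::finite \<Rightarrow> nat"
    and A :: "real ^ 'l ^ 'm"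
    and P :: "nat \<Rightarrow> real ^ 'l ^ 'l"
    and mubar :: "nat \<Rightarrow> real ^ 'l"
    and g :: "nat \<Rightarrow> (real ^ 'n) \<times> (real ^ 'm) \<times> (real ^ 'l) \<Rightarrow>
                (real ^ 'n) \<times> (real ^ 'm) \<times> (real ^ 'l) \<times> (real ^ 'l)"
    and xxbar :: "nat \<Rightarrow> (real ^ 'n) \<times> (real ^ 'm) \<times> (real ^ 'l)"
  assumes h_proper: "proper_fun h"
    and h_convex: "convex_fun h"
    and h_int_dom: "interior (eff_dom h) \<noteq> {}"
    and h_dom: "eff_dom h = (\<Union>k\<in>{1..K}. C k)"
    and Q_sym: "\<forall>k\<in>{1..K}. transpose (Q k) = Q k"
    and h_on_piece: "\<forall>k\<in>{1..K}. \<forall>z\<in>C k.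
           h z = ereal (1 / 2 * (z \<bullet> (Q k *v z)) + b k \<bullet> z + \<beta> k)"
    and a_nonzero: "\<forall>j\<in>{1..s}. a j \<noteq> 0"
    and omega_sign: "\<forall>k\<in>{1..K}. \<forall>j\<in>{1..s}. \<omega> k j \<in> {1, -1}"
    and C_eq: "\<forall>k\<in>{1..K}. C k = {z. \<forall>j\<in>{1..s}. (\<omega> k j *\<^sub>R a j) \<bullet> z \<le> \<omega> k j * \<alpha> j}"
    and C_int: "\<forall>k\<in>{1..K}. interior (C k) =
                  {z. \<forall>j\<in>{1..s}. (\<omega> k j *\<^sub>R a j) \<bullet> z < \<omega> k j * \<alpha> j}"
    and C_int_nonempty: "\<forall>k\<in>{1..K}. interior (C k) \<noteq> {}"
    and C_int_disjoint: "\<forall>k1\<in>{1..K}. \<forall>k2\<in>{1..K}.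
           k1 \<noteq> k2 \<longrightarrow> interior (C k1) \<inter> interior (C k2) = {}"
    and c_C3: "Ck_smooth 3 c"
    and xbar_dom: "xbar \<in> eff_dom (h \<circ> c)"
    and cbar_eq: "cbar = c xbar"
    and kk_enum: "bij_betw kk {1..kbar} (active_pieces K C cbar)"
    and kbar_ge_2: "kbar \<ge> 2"
    and cbar_manifold: "cbar \<in> active_manifold K C cbar"
    and e_enum: "bij_betw e UNIV (active_constraints s a \<alpha> cbar)"
    and A_cols: "\<forall>r. column r A = \<omega> (kk kbar) (e r) *\<^sub>R a (e r)"
    and P_diag: "\<forall>i\<in>{1..kbar}. \<forall>p r. p \<noteq> r \<longrightarrow> P i $ p $ r = 0"
    and P_sign: "\<forall>i\<in>{1..kbar}. \<forall>r. P i $ r $ r \<in> {1, -1}"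
    and AP_cols: "\<forall>i\<in>{1..kbar}. \<forall>r. column r (A ** P i) = \<omega> (kk i) (e r) *\<^sub>R a (e r)"
    and A_null: "null_space A = {0}"
    and ybar_unique: "null_space (transpose (jacobian c (at xbar)))
                        \<inter> rel_interior (subdifferential h cbar) = {ybar}"
    and ybar_repr: "\<forall>i\<in>{1..kbar}.
           ybar = Q (kk i) *v cbar + b (kk i) + (A ** P i) *v mubar i"
    and mubar_pos: "\<forall>i\<in>{1..kbar}. \<forall>r. mubar i $ r > 0"
    and second_order: "\<forall>d \<in> null_space (transpose A ** jacobian c (at xbar)) - {0}.
           second_dir_deriv h cbar (jacobian c (at xbar) *v d)
             + ereal (d \<bullet> (hessian (\<lambda>x. ybar \<bullet> c x) xbar *v d)) > 0"
    and g_eq: "\<forall>j\<in>{1..kbar}. g j = g_map c cbar (Q (kk j)) (b (kk j)) A (P j)"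
    and xxbar_eq: "\<forall>j\<in>{1..kbar}. xxbar j = (xbar, ybar, mubar j)"
  shows "(\<forall>j\<in>{1..kbar}.
            strongly_metrically_regular (linearized_map (g j) G0_set (xxbar j)) (xxbar j) 0) \<and>
         (\<forall>j\<in>{1..kbar}. \<exists>U. open U \<and> xxbar j \<in> U \<and>
            (\<forall>x0\<in>U.
               (\<exists>!X. X 0 = x0 \<and> (\<forall>k. X k \<in> U) \<and> newton_sequence (g j) G0_set X) \<and>
               (\<forall>X. X 0 = x0 \<and> (\<forall>k. X k \<in> U) \<and> newton_sequence (g j) G0_set X \<longrightarrow>
                  converges_quadratically X (xxbar j) \<and>
                  converges_quadratically (\<lambda>k. (fst (X k), fst (snd (X k)))) (xbar, ybar))))"
proof -
  define J where "J = jacobian c (at xbar)"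
  let ?H = "hessian (\<lambda>x. ybar \<bullet> c x) xbar"
  have active: "kk i \<in> {1..K}" "cbar \<in> C (kk i)" if "i \<in> {1..kbar}" for i
    using bij_betwE[OF kk_enum] that by (auto simp: active_pieces_def)
  have active_enum: "\<exists>i\<in>{1..kbar}. k = kk i" if "k \<in> active_pieces K C cbar" for k
    using bij_betw_imp_surj_on[OF kk_enum] that by (metis imageE)
  have \<omega>0: "\<omega> k j \<noteq> 0" if "k \<in> {1..K}" "j \<in> {1..s}" for k j
    using omega_sign that by fastforce
  have e: "e r \<in> {1..s}" "a (e r) \<bullet> cbar = \<alpha> (e r)" for r
    using bij_betwE[OF e_enum] by (auto simp: active_constraints_def)
  have e_onto: "\<exists>r. j = e r" if "j \<in> {1..s}" "a j \<bullet> cbar = \<alpha> j" for j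
    using bij_betw_imp_surj_on[OF e_enum] that unfolding active_constraints_def by blast
  have PP: "P i *v (P i *v v) = v" if "i \<in> {1..kbar}" for i v
    using P_diag P_sign that by (intro diagonal_sign_matrix_involution) auto
  have C: "C k = {z. \<forall>j\<in>{1..s}. (\<omega> k j *\<^sub>R a j) \<bullet> z \<le> \<omega> k j * \<alpha> j}" if "k \<in> {1..K}" for k
    using C_eq that by blast
  have C': "C k = (\<Inter>j\<in>{1..s}. {z. (\<omega> k j *\<^sub>R a j) \<bullet> z \<le> \<omega> k j * \<alpha> j})" if "k \<in> {1..K}" for k
    using C[OF that] by auto
  have C_convex: "convex (C k)" if "k \<in> {1..K}" for k
    unfolding C'[OF that] by (intro convex_INT convex_halfspace_le)
  have C_closed: "closed (C k)" if "k \<in> {1..K}" for k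
    unfolding C'[OF that] by (intro closed_INT ballI closed_halfspace_le)
  have J_ybar: "transpose J *v ybar = 0" and ybar_ri: "ybar \<in> rel_interior (subdifferential h cbar)"
    using ybar_unique by (auto simp: null_space_def J_def)

  \<comment> \<open>A direction annihilated by the transpose of \<open>A\<close> is tangent to every
    active hyperplane, so the ray from \<open>cbar\<close> stays for small \<open>t\<close> in each
    active piece, and the matrix of any of them gives the second derivative of
    \<open>h\<close>.\<close>
  have curvature: "0 < (J *v d) \<bullet> (Q (kk i) *v (J *v d)) + d \<bullet> (?H *v d)"
    if i: "i \<in> {1..kbar}" and d: "transpose A *v (J *v d) = 0" "d \<noteq> 0" for i d
  proof -
    let ?k = "kk i" and ?w = "J *v d"
    have flat: "a j \<bullet> ?w = 0" if j: "j \<in> {1..s}" "a j \<bullet> cbar = \<alpha> j" for j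
    proof -
      obtain r where r: "j = e r" using e_onto[OF j] by blast
      have "column r A \<bullet> ?w = 0" using d(1) transpose_mult_nth[of A ?w r] by simp
      \<comment> \<open>The columns of \<open>A\<close> carry the signs of the last active piece;
        \<open>kbar_ge_2\<close> ensures that \<open>kbar\<close> is a valid index.\<close>
      moreover have "\<omega> (kk kbar) j \<noteq> 0" using \<omega>0[OF active(1) j(1)] kbar_ge_2 by simp
      ultimately show ?thesis using A_cols r by simp
    qed
    have "\<forall>\<^sub>F t in at_right 0. cbar + t *\<^sub>R ?w \<in> C ?k"
      by (rule eventually_in_polyhedron[OF C[OF active(1)[OF i]] _ active(2)[OF i] \<omega>0[OF active(1)[OF i]] flat]) auto
    then have "\<forall>\<^sub>F t in at_right 0. h (cbar + t *\<^sub>R ?w) =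
        ereal ((1 / 2 * (cbar \<bullet> (Q ?k *v cbar)) + b ?k \<bullet> cbar + \<beta> ?k)
          + t * ((Q ?k *v cbar + b ?k) \<bullet> ?w) + t\<^sup>2 / 2 * (?w \<bullet> (Q ?k *v ?w)))"
    proof eventually_elim
      case (elim t)
      have "transpose (Q ?k) = Q ?k" using Q_sym active(1)[OF i] by blast
      from quadratic_expansion[OF this] show ?case
        using h_on_piece active(1)[OF i] elim by simp
    qed
    then have "second_dir_deriv h cbar ?w = ereal (?w \<bullet> (Q ?k *v ?w))"
      using h_on_piece active[OF i] by (intro second_dir_deriv_quadratic) auto
    moreover have "d \<in> null_space (transpose A ** jacobian c (at xbar)) - {0}"
      using d by (simp add: null_space_def J_def flip: matrix_vector_mul_assoc del: transpose_matrix_vector)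
    ultimately have "0 < ereal (?w \<bullet> (Q ?k *v ?w)) + ereal (d \<bullet> (?H *v d))"
      using second_order unfolding J_def by metis
    then show ?thesis by simp
  qed

  have nondegenerate: "\<nu> = 0"
    if j: "j \<in> {1..kbar}" and \<nu>: "transpose J *v ((A ** P j) *v \<nu>) = 0" for j \<nu>
  proof -
    define \<eta> where "\<eta> = (A ** P j) *v \<nu>"
    \<comment> \<open>As each \<open>P i\<close> is its own inverse, these are the coordinates of
      the one vector \<eta> in the columns signed for piece \<open>i\<close>.\<close>
    define \<nu>' where "\<nu>' i = P i *v (P j *v \<nu>)" for i
    have \<eta>: "\<eta> = (A ** P i) *v \<nu>' i" if "i \<in> {1..kbar}" for i
      using PP[OF that] by (simp add: \<eta>_def \<nu>'_def flip: matrix_vector_mul_assoc)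
    have "\<forall>\<^sub>F t in at_right 0. 0 < (mubar i + t *\<^sub>R \<nu>' i) $ r" if "i \<in> {1..kbar}" for i r
    proof -
      have "((\<lambda>t. mubar i $ r + t * \<nu>' i $ r) \<longlongrightarrow> mubar i $ r + 0 * \<nu>' i $ r) (at_right 0)"
        by (intro tendsto_intros)
      then show ?thesis using mubar_pos that by (auto dest!: order_tendstoD(1)[of _ _ _ 0])
    qed
    \<comment> \<open>Finitely many strict inequalities allow a common step length for all active
      pieces.\<close>
    then have "\<forall>\<^sub>F t in at_right 0. \<forall>i\<in>{1..kbar}. \<forall>r. 0 < (mubar i + t *\<^sub>R \<nu>' i) $ r"
      by (intro eventually_ball_finite eventually_all_finite ballI) auto
    then have "\<forall>\<^sub>F t in at_right 0. 0 < t \<and> (\<forall>i\<in>{1..kbar}. \<forall>r. 0 < (mubar i + t *\<^sub>R \<nu>' i) $ r)"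
      using eventually_at_right_less by (rule eventually_conj[rotated])
    then obtain \<epsilon> where "0 < \<epsilon>" and \<epsilon>: "\<And>i r. i \<in> {1..kbar} \<Longrightarrow> 0 < (mubar i + \<epsilon> *\<^sub>R \<nu>' i) $ r"
      using eventually_happens'[OF trivial_limit_at_right_real] by (metis (no_types, lifting))
    have "ybar + \<epsilon> *\<^sub>R \<eta> \<in> subdifferential h cbar"
    proof (rule subdifferential_piecewiseI[OF h_convex h_dom C_convex C_closed])
      show "transpose (Q k) = Q k" if "k \<in> {1..K}" for k using Q_sym that by blast
      show "h z = ereal (1 / 2 * (z \<bullet> (Q k *v z)) + b k \<bullet> z + \<beta> k)" if "k \<in> {1..K}" "z \<in> C k" for k z
        using h_on_piece that by blast
      show "cbar \<in> eff_dom h" using xbar_dom by (simp add: eff_dom_def cbar_eq)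
      fix k w assume k: "k \<in> active_pieces K C cbar" and w: "w \<in> C k"
      obtain i where i: "i \<in> {1..kbar}" "k = kk i" using active_enum[OF k] by blast
      let ?\<mu> = "mubar i + \<epsilon> *\<^sub>R \<nu>' i"
      have "ybar + \<epsilon> *\<^sub>R \<eta> = Q k *v cbar + b k + (A ** P i) *v ?\<mu>"
        using ybar_repr i by (simp add: \<eta>[OF i(1)] matrix_vector_right_distrib matrix_vector_mult_scaleR)
      \<comment> \<open>The columns of \<open>A ** P i\<close> are outward normals of constraints of
        \<open>C k\<close> active at \<open>cbar\<close>, so nonnegative combinations of them lie in
        the normal cone.\<close>
      moreover have "((A ** P i) *v ?\<mu>) \<bullet> (w - cbar) \<le> 0"
        unfolding matrix_vector_inner_columns
      proof (intro sum_nonpos mult_nonneg_nonpos)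
        fix r
        show "0 \<le> ?\<mu> $ r" using \<epsilon>[OF i(1)] by (simp add: less_imp_le)
        have "(\<omega> k (e r) *\<^sub>R a (e r)) \<bullet> w \<le> \<omega> k (e r) * \<alpha> (e r)"
          using w C active(1)[OF i(1)] e(1) i(2) by blast
        then show "column r (A ** P i) \<bullet> (w - cbar) \<le> 0"
          using AP_cols i e(2)[of r] by (simp add: inner_diff_right)
      qed
      ultimately show "(ybar + \<epsilon> *\<^sub>R \<eta>) \<bullet> (w - cbar) \<le> (Q k *v cbar + b k) \<bullet> (w - cbar)"
        by (simp add: inner_add_left)
    qed
    then obtain t where t: "0 < t" "ybar + t *\<^sub>R \<eta> \<in> rel_interior (subdifferential h cbar)"
      using rel_interior_move[OF ybar_ri \<open>0 < \<epsilon>\<close>] by blast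
    have "transpose J *v (ybar + t *\<^sub>R \<eta>) = 0"
      using J_ybar \<nu> by (simp add: \<eta>_def matrix_vector_right_distrib matrix_vector_mult_scaleR del: transpose_matrix_vector)
    then have "ybar + t *\<^sub>R \<eta> \<in> null_space (transpose J)" by (simp add: null_space_def)
    \<comment> \<open>The shifted dual vector meets both conditions that single out
      \<open>ybar\<close>; with \<open>0 < t\<close> this forces \<open>\<eta> = 0\<close>, and the
      trivial null space of \<open>A\<close> gives \<open>\<nu> = 0\<close>.\<close>
    then have "ybar + t *\<^sub>R \<eta> \<in> {ybar}" using t(2) ybar_unique unfolding J_def by blast
    then have "A *v (P j *v \<nu>) = 0" using t(1) by (simp add: \<eta>_def matrix_vector_mul_assoc)
    then have "P j *v \<nu> = 0" using A_null by (auto simp: null_space_def)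
    then show ?thesis using PP[OF j, of \<nu>] by simp
  qed

  \<comment> \<open>The optimality system at the reference point\<close>
  have root: "kkt_map c cbar (Q (kk j)) (b (kk j)) A (xbar, ybar) + multiplier_map (A ** P j) (mubar j) = 0"
    if "j \<in> {1..kbar}" for j
    using J_ybar ybar_repr that
    by (simp add: kkt_map_def multiplier_map_def zero_prod_def J_def cbar_eq del: transpose_matrix_vector)
  have injective: "d = 0 \<and> \<eta> = 0 \<and> \<nu> = 0"
    if j: "j \<in> {1..kbar}"
      and "frechet_derivative (kkt_map c cbar (Q (kk j)) (b (kk j)) A) (at (xbar, ybar)) (d, \<eta>)
        + multiplier_map (A ** P j) \<nu> = 0" for j d \<eta> \<nu>
  proof -
    have "?H *v d + transpose J *v \<eta> = 0" "\<eta> - Q (kk j) *v (J *v d) - (A ** P j) *v \<nu> = 0"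
      "transpose A *v (J *v d) = 0"
      using that(2) unfolding kkt_map_frechet_derivative[OF c_C3] J_def[symmetric]
      by (simp_all add: multiplier_map_def zero_prod_def del: transpose_matrix_vector)
    from kkt_system_injective[OF _ _ this] show ?thesis
      using curvature[OF j] nondegenerate[OF j] by blast
  qed
  show ?thesis
  proof (intro conjI ballI)
    fix j assume j: "j \<in> {1..kbar}"
    have gj: "g j = g_map c cbar (Q (kk j)) (b (kk j)) A (P j)" and xj: "xxbar j = (xbar, ybar, mubar j)"
      using g_eq xxbar_eq j by auto
    have pos: "0 < mubar j $ i" for i using mubar_pos j by blast
    note regularity = kkt_newton_regularity[OF c_C3 root[OF j] pos]
    show "strongly_metrically_regular (linearized_map (g j) G0_set (xxbar j)) (xxbar j) 0"
      unfolding gj xj by (rule regularity(1)) (rule injective[OF j])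
    show "\<exists>U. open U \<and> xxbar j \<in> U \<and>
            (\<forall>x0\<in>U.
               (\<exists>!X. X 0 = x0 \<and> (\<forall>k. X k \<in> U) \<and> newton_sequence (g j) G0_set X) \<and>
               (\<forall>X. X 0 = x0 \<and> (\<forall>k. X k \<in> U) \<and> newton_sequence (g j) G0_set X \<longrightarrow>
                  converges_quadratically X (xxbar j) \<and>
                  converges_quadratically (\<lambda>k. (fst (X k), fst (snd (X k)))) (xbar, ybar)))"
      unfolding gj xj by (rule regularity(2)) (rule injective[OF j])
  qed
qed

end
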